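(* Assume that $\varphi$ is non-contractive, and let $(S,\iota)$ be a free analytic 1-submanifold of $M$ with $S\cong D$ (homeomorphic to an interval) and $S\notin\mathcal F(S)$. Let $\Sigma\in\mathcal M(S)$ be compact with $\Sigma\subset\mathrm{int}[S]$, with $\Sigma$-decomposition $(\{\Sigma_n\}_{n\in\mathfrak n},\{[g_n]\}_{n\in\mathfrak n})$. Let $g\in G$, and let $O,O'\subseteq S$ be open segments such that $\iota|_O$, $\iota|_{O'}$ are embeddings and $O\subseteq\Sigma_0$. If $g\cdot\iota(O)=\iota(O')$, then there is a unique $n\in\mathfrak n$ such that $[g]=[g_n]$ and $O'\subseteq\Sigma_n$. In particular, a $\Sigma$-decomposition is unique up to change of orientation, i.e. up to replacing it by $(\{\overline\Sigma_n\}_{n\in\overline{\mathfrak n}},\{[\overline g_n]\}_{n\in\overline{\mathfrak n}})$ with $\overline{\mathfrak n}:=\{-n\mid n\in\mathfrak n\}$, $\overline\Sigma_n:=\Sigma_{-n}$ and $[\overline g_n]:=[g_{-n}]$ for all $n\in\overline{\mathfrak n}$.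
   Context: Manifolds and Lie groups are finite-dimensional, Hausdorff, real analytic, without boundary unless stated otherwise, and not assumed second countable. $\varphi\colon G\times M\to M$, $(g,x)\mapsto g\cdot x$, is a left action of a Lie group $G$ on an analytic manifold $M$ such that $g\mapsto g\cdot x$ is continuous for each $x\in M$. $\varphi$ is analytic in $M$ if $x\mapsto g\cdot x$ is analytic for each $g\in G$; it is non-contractive if it is analytic in $M$ and for each $C\subseteq M$ with $|C|\ge 2$ and each $x\in M\setminus C$ there is a neighbourhood $U$ of $x$ with $g\cdot C\not\subseteq U$ for all $g\in G$. An analytic 1-submanifold $(S,\iota)$ of $M$ consists of a connected, Hausdorff, second countable 1-dimensional analytic manifold $S$ with (possibly empty) boundary and an injective analytic immersion $\iota\colon S\to M$. $S\cong D$ means that there is a homeomorphism $\upsilon\colon D\to S$ with $D\subseteq\mathbb R$ a nondegenerate interval. A segment is a connected subset of $S$ with more than one point; $\mathrm{Seg}(S)$ is the set of segments. For $\Sigma\in\mathrm{Seg}(S)$: $\mathrm{int}[\Sigma]:=\upsilon(\text{interior of }\upsilon^{-1}(\Sigma)\text{ in }\mathbb R)$ and $\partial_\Sigma:=\Sigma\setminus\mathrm{int}[\Sigma]$. A boundary segment of $\Sigma$ is a segment $\Sigma'\subseteq\Sigma$ with $\Sigma\setminus\Sigma'$ connected (possibly empty). The symbol $\subset$ means proper inclusion. $g\cdot\iota$ denotes $z\mapsto g\cdot\iota(z)$; $G_S:=\bigcap_{z\in S}G_{\iota(z)}$ (intersection of stabilizers), $\mathcal H(S):=G/G_S$ (left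 cosets), and $[g]\in\mathcal H(S)$ is the class of $g$. For $\Sigma,\Sigma'\in\mathrm{Seg}(S)$ and $g\in G$, write $g\cdot\iota|_\Sigma\sim_\circ\iota|_{\Sigma'}$ if $g\cdot\iota(O)=\iota(O')$ for open (in $S$) segments $O\subseteq\Sigma$, $O'\subseteq\Sigma'$ on which $\iota$ is an embedding. $\Sigma\in\mathrm{Seg}(S)$ is a free segment, $\Sigma\in\mathcal F(S)$, if for $g\in G$: $g\cdot\iota|_\Sigma\sim_\circ\iota|_\Sigma\Leftrightarrow g\in G_S$. $\mathcal M(S)$ is the set of inclusion-maximal elements of $\mathcal F(S)$. $(S,\iota)$ is free if $\mathcal F(S)\neq\emptyset$. $\Sigma$-decomposition ($S\cong D$). For compact $\Sigma\in\mathcal M(S)$, $\Sigma\subset\mathrm{int}[S]$: a $\Sigma$-decomposition is a pair $(\{\Sigma_n\}_{n\in\mathfrak n},\{[g_n]\}_{n\in\mathfrak n})$ with $\mathfrak n=\{n\in\mathbb Z\mid\mathfrak n_-\le n\le\mathfrak n_+\}$, $\mathfrak n_\pm\in\mathbb Z_{\ne0}\cup\{-\infty,\infty\}$, $\mathfrak n_-<0<\mathfrak n_+$, $[g_n]\in\mathcal H(S)$, and segments $\Sigma_n$ on which $\iota$ is an embedding, such that: $\Sigma_0=\Sigma$, and $\Sigma_{\mathfrak n_\pm}$ is a boundary segment of $S$ if $\mathfrak n_\pm\ne\pm\infty$; $\Sigma_p\cap\Sigma_q=\partial_{\Sigma_p}\cap\partial_{\Sigma_q}$ is a singleton for $|p-q|=1$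 and empty for $|p-q|\ge2$; $g_n\cdot\iota(\Sigma_0)=\iota(\Sigma_n)$ for $\mathfrak n_-<n<\mathfrak n_+$, and $g_{\mathfrak n_\pm}\cdot\iota(\Sigma_\pm)=\iota(\Sigma_{\mathfrak n_\pm})$ if $\mathfrak n_\pm\neq\pm\infty$, for certain boundary segments $\Sigma_\pm$ of $\Sigma_0$. *)

theory Defs
  imports
    "HOL-Analysis.Analysis"
    "HOL-Algebra.Group_Action"
    "HOL-Algebra.Left_Coset"
    "HOL-Library.Extended"
begin

section \<open>Analytic manifolds\<close>

text \<open>
  \<open>\<real>\<^sup>n\<close> is \<^const>\<open>Euclidean_space\<close> \<open>n\<close>, that is, the sequences \<^typ>\<open>nat \<Rightarrow> real\<close> vanishing from index
  \<open>n\<close> on. This allows \<open>n = 0\<close> (discrete Lie groups). Multi-indices in \<open>n\<close> variables are likewise the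
  sequences \<^typ>\<open>nat \<Rightarrow> nat\<close> vanishing from index \<open>n\<close> on.

  \<open>A\<close> need not be open: the power series converges to \<open>F\<close> on a full cube around \<open>x\<close>, and \<open>f\<close>
  agrees with \<open>F\<close> on the part of the cube that lies in \<open>A\<close>. So at a boundary point of a half-space,
  \<open>f\<close> is required to extend analytically to a neighbourhood in \<open>\<real>\<^sup>n\<close>.
\<close>

definition real_analytic_on ::
    "nat \<Rightarrow> ((nat \<Rightarrow> real) \<Rightarrow> real) \<Rightarrow> (nat \<Rightarrow> real) set \<Rightarrow> bool" where
  "real_analytic_on n f A \<longleftrightarrow>
     (\<forall>x\<in>A. \<exists>r>0. \<exists>(a :: (nat \<Rightarrow> nat) \<Rightarrow> real) F.
        \<forall>y\<in>topspace (Euclidean_space n). (\<forall>i<n. \<bar>y i - x i\<bar> < r) \<longrightarrow>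
          ((\<lambda>\<alpha>. a \<alpha> * (\<Prod>i<n. (y i - x i) ^ \<alpha> i)) has_sum F y) {\<alpha>. \<forall>i\<ge>n. \<alpha> i = 0} \<and>
          (y \<in> A \<longrightarrow> f y = F y))"

type_synonym 'a chart = "'a set \<times> ('a \<Rightarrow> nat \<Rightarrow> real)"

text \<open>
  \<open>H\<close> is the set on which the manifold is modelled: everything, or a closed half-space. Atlases are
  not required to be maximal; an analytic structure is given by any one of its atlases. Modelling on
  the half-space \<open>0 \<le> x\<^sub>0\<close> covers manifolds with empty boundary too: chart images may lie in its
  interior.
\<close>

definition analytic_atlas ::
    "nat \<Rightarrow> (nat \<Rightarrow> real) set \<Rightarrow> 'a topology \<Rightarrow> 'a chart set \<Rightarrow> bool" where
  "analytic_atlas n H X \<A> \<longleftrightarrow>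
     (\<Union>(U, \<psi>)\<in>\<A>. U) = topspace X \<and>
     (\<forall>(U, \<psi>)\<in>\<A>.
        openin X U \<and>
        openin (subtopology (Euclidean_space n) H) (\<psi> ` U) \<and>
        homeomorphic_map (subtopology X U) (subtopology (Euclidean_space n) (\<psi> ` U)) \<psi>) \<and>
     (\<forall>(U, \<psi>)\<in>\<A>. \<forall>(V, \<eta>)\<in>\<A>. \<forall>i<n.
        real_analytic_on n (\<lambda>p. \<eta> (inv_into U \<psi> p) i) (\<psi> ` (U \<inter> V)))"

definition analytic_manifold :: "nat \<Rightarrow> 'a topology \<Rightarrow> 'a chart set \<Rightarrow> bool" where
  "analytic_manifold n X \<A> \<longleftrightarrow> Hausdorff_space X \<and> analytic_atlas n UNIV X \<A>"

definition analytic_manifold_with_boundary ::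
    "nat \<Rightarrow> 'a topology \<Rightarrow> 'a chart set \<Rightarrow> bool" where
  "analytic_manifold_with_boundary n X \<A> \<longleftrightarrow>
     Hausdorff_space X \<and> analytic_atlas n {x. 0 \<le> x 0} X \<A>"

definition analytic_map ::
    "nat \<Rightarrow> 'a topology \<Rightarrow> 'a chart set \<Rightarrow> nat \<Rightarrow> 'b topology \<Rightarrow> 'b chart set \<Rightarrow>
     ('a \<Rightarrow> 'b) \<Rightarrow> bool" where
  "analytic_map m X \<A> n Y \<B> f \<longleftrightarrow>
     continuous_map X Y f \<and>
     (\<forall>(U, \<psi>)\<in>\<A>. \<forall>(V, \<eta>)\<in>\<B>. \<forall>i<n.
        real_analytic_on m (\<lambda>p. \<eta> (f (inv_into U \<psi> p)) i) (\<psi> ` (U \<inter> f -` V)))"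

text \<open>
  In charts, the Jacobian matrix \<open>J\<close> of \<open>f\<close> (partial derivatives, one-sided at boundary points) has
  trivial kernel.
\<close>

definition immersion ::
    "nat \<Rightarrow> 'a chart set \<Rightarrow> nat \<Rightarrow> 'b chart set \<Rightarrow> ('a \<Rightarrow> 'b) \<Rightarrow> bool" where
  "immersion m \<A> n \<B> f \<longleftrightarrow>
     (\<forall>(U, \<psi>)\<in>\<A>. \<forall>(V, \<eta>)\<in>\<B>. \<forall>p\<in>\<psi> ` (U \<inter> f -` V).
        \<exists>J :: nat \<Rightarrow> nat \<Rightarrow> real.
          (\<forall>i<n. \<forall>j<m.
             ((\<lambda>t. \<eta> (f (inv_into U \<psi> (p(j := t)))) i) has_real_derivative J i j)
               (at (p j) within {t. p(j := t) \<in> \<psi> ` (U \<inter> f -` V)})) \<and>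
          (\<forall>v :: nat \<Rightarrow> real. (\<forall>i<n. (\<Sum>j<m. J i j * v j) = 0) \<longrightarrow> (\<forall>j<m. v j = 0)))"


section \<open>Lie groups and actions\<close>

definition prod_atlas :: "nat \<Rightarrow> 'a chart set \<Rightarrow> 'b chart set \<Rightarrow> ('a \<times> 'b) chart set" where
  "prod_atlas m \<A> \<B> =
     {(U \<times> V, \<lambda>(x, y) i. if i < m then \<psi> x i else \<eta> y (i - m)) | U \<psi> V \<eta>.
        (U, \<psi>) \<in> \<A> \<and> (V, \<eta>) \<in> \<B>}"

definition lie_group ::
    "nat \<Rightarrow> ('g, 'r) monoid_scheme \<Rightarrow> 'g topology \<Rightarrow> 'g chart set \<Rightarrow> bool" where
  "lie_group k G T \<A> \<longleftrightarrow>
     group G \<and> topspace T = carrier G \<and> analytic_manifold k T \<A> \<and>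
     analytic_map (k + k) (prod_topology T T) (prod_atlas k \<A> \<A>) k T \<A>
       (\<lambda>(g, h). g \<otimes>\<^bsub>G\<^esub> h) \<and>
     analytic_map k T \<A> k T \<A> (\<lambda>g. inv\<^bsub>G\<^esub> g)"

definition pointwise_continuous_action ::
    "('g, 'r) monoid_scheme \<Rightarrow> 'g topology \<Rightarrow> 'm topology \<Rightarrow> ('g \<Rightarrow> 'm \<Rightarrow> 'm) \<Rightarrow> bool" where
  "pointwise_continuous_action G T M \<phi> \<longleftrightarrow>
     group_action G (topspace M) \<phi> \<and>
     (\<forall>x\<in>topspace M. continuous_map T M (\<lambda>g. \<phi> g x))"

definition non_contractive ::
    "('g, 'r) monoid_scheme \<Rightarrow> nat \<Rightarrow> 'm topology \<Rightarrow> 'm chart set \<Rightarrow> ('g \<Rightarrow> 'm \<Rightarrow> 'm) \<Rightarrow> bool" where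
  "non_contractive G d M \<A> \<phi> \<longleftrightarrow>
     (\<forall>g\<in>carrier G. analytic_map d M \<A> d M \<A> (\<phi> g)) \<and>
     (\<forall>C x. C \<subseteq> topspace M \<and> (\<exists>a\<in>C. \<exists>b\<in>C. a \<noteq> b) \<and> x \<in> topspace M - C \<longrightarrow>
        (\<exists>U. openin M U \<and> x \<in> U \<and> (\<forall>g\<in>carrier G. \<not> \<phi> g ` C \<subseteq> U)))"


section \<open>Analytic 1-submanifolds and their segments\<close>

definition analytic_1_submanifold ::
    "nat \<Rightarrow> 'm topology \<Rightarrow> 'm chart set \<Rightarrow> 's topology \<Rightarrow> 's chart set \<Rightarrow> ('s \<Rightarrow> 'm) \<Rightarrow> bool" where
  "analytic_1_submanifold d M \<A> S \<S> \<iota> \<longleftrightarrow>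
     analytic_manifold_with_boundary 1 S \<S> \<and> connected_space S \<and> second_countable S \<and>
     analytic_map 1 S \<S> d M \<A> \<iota> \<and> immersion 1 \<S> d \<A> \<iota> \<and> inj_on \<iota> (topspace S)"

definition segment :: "'s topology \<Rightarrow> 's set \<Rightarrow> bool" where
  "segment S \<Sigma> \<longleftrightarrow> connectedin S \<Sigma> \<and> (\<exists>a\<in>\<Sigma>. \<exists>b\<in>\<Sigma>. a \<noteq> b)"

definition open_segment_in :: "'s topology \<Rightarrow> 's set \<Rightarrow> bool" where
  "open_segment_in S O1 \<longleftrightarrow> segment S O1 \<and> openin S O1"

definition boundary_segment :: "'s topology \<Rightarrow> 's set \<Rightarrow> 's set \<Rightarrow> bool" where
  "boundary_segment S \<Sigma> \<Sigma>' \<longleftrightarrow>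
     segment S \<Sigma>' \<and> \<Sigma>' \<subseteq> \<Sigma> \<and> connectedin S (\<Sigma> - \<Sigma>')"

definition interval_parametrization :: "real set \<Rightarrow> 's topology \<Rightarrow> (real \<Rightarrow> 's) \<Rightarrow> bool" where
  "interval_parametrization D S \<upsilon> \<longleftrightarrow>
     is_interval D \<and> (\<exists>a\<in>D. \<exists>b\<in>D. a \<noteq> b) \<and> homeomorphic_map (top_of_set D) S \<upsilon>"

definition seg_int :: "real set \<Rightarrow> (real \<Rightarrow> 's) \<Rightarrow> 's set \<Rightarrow> 's set" where
  "seg_int D \<upsilon> \<Sigma> = \<upsilon> ` interior {t \<in> D. \<upsilon> t \<in> \<Sigma>}"

definition seg_bd :: "real set \<Rightarrow> (real \<Rightarrow> 's) \<Rightarrow> 's set \<Rightarrow> 's set" where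
  "seg_bd D \<upsilon> \<Sigma> = \<Sigma> - seg_int D \<upsilon> \<Sigma>"

text \<open>As \<open>\<iota>\<close> is an immersion, it is an embedding on \<open>A\<close> iff it is a topological embedding there.\<close>

definition embedded_on :: "'m topology \<Rightarrow> 's topology \<Rightarrow> ('s \<Rightarrow> 'm) \<Rightarrow> 's set \<Rightarrow> bool" where
  "embedded_on M S \<iota> A \<longleftrightarrow> embedding_map (subtopology S A) M \<iota>"

definition overlaps ::
    "'m topology \<Rightarrow> ('g \<Rightarrow> 'm \<Rightarrow> 'm) \<Rightarrow> 's topology \<Rightarrow> ('s \<Rightarrow> 'm) \<Rightarrow> 'g \<Rightarrow> 's set \<Rightarrow> 's set \<Rightarrow> bool" where
  "overlaps M \<phi> S \<iota> g \<Sigma> \<Sigma>' \<longleftrightarrow>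
     (\<exists>O1 O2. open_segment_in S O1 \<and> O1 \<subseteq> \<Sigma> \<and> embedded_on M S \<iota> O1 \<and>
              open_segment_in S O2 \<and> O2 \<subseteq> \<Sigma>' \<and> embedded_on M S \<iota> O2 \<and>
              \<phi> g ` \<iota> ` O1 = \<iota> ` O2)"

definition curve_stabilizer ::
    "('g, 'r) monoid_scheme \<Rightarrow> ('g \<Rightarrow> 'm \<Rightarrow> 'm) \<Rightarrow> 's topology \<Rightarrow> ('s \<Rightarrow> 'm) \<Rightarrow> 'g set" where
  "curve_stabilizer G \<phi> S \<iota> = (\<Inter>z\<in>topspace S. stabilizer G \<phi> (\<iota> z))"

definition curve_class ::
    "('g, 'r) monoid_scheme \<Rightarrow> ('g \<Rightarrow> 'm \<Rightarrow> 'm) \<Rightarrow> 's topology \<Rightarrow> ('s \<Rightarrow> 'm) \<Rightarrow> 'g \<Rightarrow> 'g set" where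
  "curve_class G \<phi> S \<iota> g = g <#\<^bsub>G\<^esub> curve_stabilizer G \<phi> S \<iota>"

definition free_segments ::
    "('g, 'r) monoid_scheme \<Rightarrow> 'm topology \<Rightarrow> ('g \<Rightarrow> 'm \<Rightarrow> 'm) \<Rightarrow> 's topology \<Rightarrow> ('s \<Rightarrow> 'm) \<Rightarrow>
     's set set" where
  "free_segments G M \<phi> S \<iota> =
     {\<Sigma>. segment S \<Sigma> \<and>
         (\<forall>g\<in>carrier G. overlaps M \<phi> S \<iota> g \<Sigma> \<Sigma> \<longleftrightarrow> g \<in> curve_stabilizer G \<phi> S \<iota>)}"

definition maximal_free_segments ::
    "('g, 'r) monoid_scheme \<Rightarrow> 'm topology \<Rightarrow> ('g \<Rightarrow> 'm \<Rightarrow> 'm) \<Rightarrow> 's topology \<Rightarrow> ('s \<Rightarrow> 'm) \<Rightarrow>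
     's set set" where
  "maximal_free_segments G M \<phi> S \<iota> =
     {\<Sigma> \<in> free_segments G M \<phi> S \<iota>. \<forall>\<Sigma>'\<in>free_segments G M \<phi> S \<iota>. \<Sigma> \<subseteq> \<Sigma>' \<longrightarrow> \<Sigma>' = \<Sigma>}"


section \<open>Decompositions\<close>

definition index_set :: "int extended \<Rightarrow> int extended \<Rightarrow> int set" where
  "index_set lo hi = {n. lo \<le> Fin n \<and> Fin n \<le> hi}"

text \<open>
  \<open>Sg\<close> and \<open>c\<close> are the families of segments \<open>\<Sigma>\<^sub>n\<close> and of classes \<open>[g\<^sub>n]\<close>; their values outside the
  index set are irrelevant. Elements of \<open>G\<^sub>S\<close> fix \<open>\<iota>(S)\<close> pointwise, so the choice of the
  representatives \<open>g\<^sub>n\<close> is immaterial.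
\<close>

definition segment_decomposition ::
    "('g, 'r) monoid_scheme \<Rightarrow> 'm topology \<Rightarrow> ('g \<Rightarrow> 'm \<Rightarrow> 'm) \<Rightarrow> 's topology \<Rightarrow> ('s \<Rightarrow> 'm) \<Rightarrow>
     real set \<Rightarrow> (real \<Rightarrow> 's) \<Rightarrow> 's set \<Rightarrow>
     int extended \<Rightarrow> int extended \<Rightarrow> (int \<Rightarrow> 's set) \<Rightarrow> (int \<Rightarrow> 'g set) \<Rightarrow> bool" where
  "segment_decomposition G M \<phi> S \<iota> D \<upsilon> \<Sigma> lo hi Sg c \<longleftrightarrow>
     lo < 0 \<and> 0 < hi \<and>
     (\<forall>n\<in>index_set lo hi.
        c n \<in> lcosets\<^bsub>G\<^esub> (curve_stabilizer G \<phi> S \<iota>) \<and>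
        segment S (Sg n) \<and> embedded_on M S \<iota> (Sg n)) \<and>
     Sg 0 = \<Sigma> \<and>
     (\<forall>n. Fin n = lo \<or> Fin n = hi \<longrightarrow> boundary_segment S (topspace S) (Sg n)) \<and>
     (\<forall>p\<in>index_set lo hi. \<forall>q\<in>index_set lo hi.
        (\<bar>p - q\<bar> = 1 \<longrightarrow>
           Sg p \<inter> Sg q = seg_bd D \<upsilon> (Sg p) \<inter> seg_bd D \<upsilon> (Sg q) \<and> is_singleton (Sg p \<inter> Sg q)) \<and>
        (\<bar>p - q\<bar> \<ge> 2 \<longrightarrow> Sg p \<inter> Sg q = {})) \<and>
     (\<forall>n. lo < Fin n \<and> Fin n < hi \<longrightarrow>
        (\<exists>g\<in>carrier G. c n = curve_class G \<phi> S \<iota> g \<and> \<phi> g ` \<iota> ` Sg 0 = \<iota> ` Sg n)) \<and>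
     (\<forall>n. Fin n = lo \<or> Fin n = hi \<longrightarrow>
        (\<exists>g\<in>carrier G. c n = curve_class G \<phi> S \<iota> g \<and>
           (\<exists>B. boundary_segment S (Sg 0) B \<and> \<phi> g ` \<iota> ` B = \<iota> ` Sg n)))"

end

theory Submission
  imports Defs
begin

text \<open>
  Pull everything back along the parametrization to intervals \<open>P n\<close> in \<open>D\<close>. Consecutive intervals meet
  in an endpoint and the others are disjoint, so they are lined up in the order of their indices, up to
  orientation. They cover \<open>D\<close>: otherwise there would be infinitely many of them accumulating at a
  point \<open>t\<close> of \<open>D\<close>, and translates of \<open>\<iota>(\<Sigma>)\<close> would shrink to the image of \<open>t\<close>, contradicting
  non-contractivity.

  Suppose \<open>g \<cdot> \<iota>(O) = \<iota>(O')\<close>. If \<open>O'\<close> meets the interior of \<open>\<Sigma>\<^sub>n\<close>, then \<open>g\<close> and \<open>g\<^sub>n\<close> map open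
  subsegments of \<open>\<Sigma>\<close> to the same image, so \<open>[g] = [g\<^sub>n]\<close> as \<open>\<Sigma>\<close> is free. Distinct indices have
  distinct classes, except possibly for the two extremal ones; but an \<open>O'\<close> meeting both extremal
  pieces also contains \<open>\<Sigma>\<^sub>0\<close>. Hence \<open>O'\<close> lies in a single piece.

  Applied to the interiors of the pieces of a second decomposition, this shows that each of two
  decompositions refines the other, so they have the same pieces. The matching of indices preserves
  adjacency and fixes \<open>0\<close>, hence it is \<open>n \<mapsto> n\<close> or \<open>n \<mapsto> -n\<close>.
\<close>

section \<open>Chains of intervals\<close>

text \<open>
  An index \<open>n\<close> is extremal in \<open>I\<close> iff \<open>n - 1\<close> or \<open>n + 1\<close> is not in \<open>I\<close>; this avoids the extended
  integers.
\<close>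

locale interval_chain =
  fixes D :: "real set" and P :: "int \<Rightarrow> real set" and I :: "int set" and a b :: real
  assumes interval_D: "is_interval D"
    and one_in: "1 \<in> I" and neg_one_in: "-1 \<in> I"
    and convex_I: "p \<in> I \<Longrightarrow> q \<in> I \<Longrightarrow> p \<le> r \<Longrightarrow> r \<le> q \<Longrightarrow> r \<in> I"
    and interval_P: "n \<in> I \<Longrightarrow> is_interval (P n)"
    and P_sub: "n \<in> I \<Longrightarrow> P n \<subseteq> D"
    and nondegenerate: "n \<in> I \<Longrightarrow> \<exists>x\<in>P n. \<exists>y\<in>P n. x < y"
    and compact_inner: "n - 1 \<in> I \<Longrightarrow> n + 1 \<in> I \<Longrightarrow> compact (P n)"
    and interval_outer: "n \<in> I \<Longrightarrow> n - 1 \<notin> I \<or> n + 1 \<notin> I \<Longrightarrow> is_interval (D - P n)"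
    and adjacent: "p \<in> I \<Longrightarrow> q \<in> I \<Longrightarrow> \<bar>p - q\<bar> = 1 \<Longrightarrow> \<exists>x. P p \<inter> P q = {x} \<and> x \<notin> interior (P p)"
    and apart: "p \<in> I \<Longrightarrow> q \<in> I \<Longrightarrow> \<bar>p - q\<bar> \<ge> 2 \<Longrightarrow> P p \<inter> P q = {}"
    and P_zero: "P 0 = {a..b}"
    and separated: "t \<in> D \<Longrightarrow> t \<notin> P 0 \<Longrightarrow>
      \<exists>e>0. \<forall>n. n - 1 \<in> I \<longrightarrow> n + 1 \<in> I \<longrightarrow> (\<exists>s\<in>P n. e \<le> \<bar>s - t\<bar>)"
begin

section \<open>The half of the chain to the right of \<open>b\<close>\<close>

lemma zero_in: "0 \<in> I"
  using convex_I[OF neg_one_in one_in, of 0] by simp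

lemma a_less_b: "a < b"
  using nondegenerate[OF zero_in] by (auto simp: P_zero)

text \<open>Induction along the chain, starting at \<open>P 0\<close>. An inner piece is a compact
  interval that starts where its predecessor ends. The point it shares with its successor is not
  interior, hence an endpoint, and it is not the left one: that belongs to the predecessor, which is
  apart from the successor. The hypothesis \<open>int k + 1 \<in> I\<close> makes
  \<open>P (int k)\<close> inner, so its \<open>Sup\<close> is a maximum.\<close>

lemma right_end:
  assumes b: "b \<in> P 1" and "int k + 1 \<in> I"
  shows "Sup (P (int k)) \<in> P (int k) \<and> Sup (P (int k)) \<in> P (int k + 1) \<and>
    P (int k + 1) \<subseteq> {Sup (P (int k))..} \<and> b \<le> Sup (P (int k)) \<and>
    (0 < k \<longrightarrow> P (int k) = {Sup (P (int (k - 1)))..Sup (P (int k))})"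
  using assms(2)
proof (induction k)
  case 0
  obtain x where x: "P 0 \<inter> P 1 = {x}"
    using adjacent[OF zero_in one_in] by auto
  then have xb: "P 0 \<inter> P 1 = {b}"
    using b a_less_b by (auto simp: P_zero)
  \<comment> \<open>By convexity, a point of \<open>P 1\<close> left of \<open>b\<close> would give
    \<open>P 0\<close> and \<open>P 1\<close> a second common point, namely
    \<open>max t a\<close>.\<close>
  have "t \<ge> b" if t: "t \<in> P 1" for t
  proof (rule ccontr)
    assume "\<not> t \<ge> b"
    then have "max t a \<in> P 1"
      using mem_is_interval_1_I[OF interval_P[OF one_in] t b, of "max t a"] a_less_b by auto
    then have "max t a \<in> P 0 \<inter> P 1"
      using \<open>\<not> t \<ge> b\<close> a_less_b by (auto simp: P_zero)
    then show False
      using xb \<open>\<not> t \<ge> b\<close> a_less_b by auto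
  qed
  then show ?case
    using b a_less_b by (auto simp: P_zero)
next
  case (Suc k)
  let ?n = "int k + 1" and ?y = "\<lambda>j. Sup (P (int j))"
  have nI: "?n \<in> I" "?n + 1 \<in> I" "int k \<in> I"
    using Suc.prems convex_I[OF zero_in Suc.prems, of ?n] convex_I[OF zero_in Suc.prems, of "int k"]
    by auto
  note IH = Suc.IH[OF nI(1)]
  have "compact (P ?n)" using compact_inner[of ?n] nI by simp
  then have "connected (P ?n)" "compact (P ?n)"
    using interval_P[OF nI(1)] is_interval_connected by auto
  then obtain u v where uv: "P ?n = {u..v}"
    using connected_compact_interval_1 by metis
  have "u < v" using nondegenerate[OF nI(1)] uv by auto
  \<comment> \<open>The induction hypothesis puts \<open>Sup (P (int k))\<close> into
    \<open>P ?n\<close> and no point of \<open>P ?n\<close> to its left.\<close>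
  have "u = ?y k" using IH uv \<open>u < v\<close> by force
  have v: "v = ?y (Suc k)" using uv \<open>u < v\<close> by (simp add: add.commute)
  obtain z where z: "P (?n) \<inter> P (?n + 1) = {z}" "z \<notin> interior (P ?n)"
    using adjacent[OF nI(1) nI(2)] by auto
  have "z \<noteq> u"
    using apart[OF nI(3) nI(2)] IH z \<open>u = ?y k\<close> by auto
  moreover have "z \<in> {u..v}" using z(1) uv by blast
  ultimately have "z = v"
    using z(2) uv by (auto simp: interior_atLeastAtMost_real)
  have "t \<ge> v" if t: "t \<in> P (?n + 1)" for t
  proof (rule ccontr)
    assume c: "\<not> t \<ge> v"
    have "v \<in> P (?n + 1)" using z \<open>z = v\<close> by auto
    then have "max t u \<in> P (?n + 1)"
      using mem_is_interval_1_I[OF interval_P[OF nI(2)] t, of v "max t u"] \<open>u < v\<close> c by auto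
    then have "max t u \<in> P ?n \<inter> P (?n + 1)"
      using c \<open>u < v\<close> by (auto simp: uv)
    then have "max t u = v" using z(1) \<open>z = v\<close> by blast
    then show False
      using c \<open>u < v\<close> by auto
  qed
  moreover have "P (int (Suc k)) = {u..v}" using uv by (simp add: add.commute)
  moreover have "v \<in> P (int (Suc k) + 1)" using z \<open>z = v\<close> by (auto simp: add.commute)
  ultimately show ?case
    using v \<open>u = ?y k\<close> \<open>u < v\<close> IH by (auto simp: add.commute)
qed

lemma right_sub:
  assumes "b \<in> P 1" and "n \<in> I" and "0 < n"
  shows "P n \<subseteq> {b..}"
proof -
  define k where "k = nat (n - 1)"
  have "n = int k + 1" using assms by (simp add: k_def)
  then show ?thesis using right_end[OF assms(1), of k] assms by force
qed

text \<open>The interval \<open>D - P n\<close> contains a point \<open>s\<close> of the preceding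
  piece, left of its end \<open>?y\<close>. If it also contained some \<open>t\<close> beyond
  \<open>?y\<close>, it would contain \<open>?y\<close>, which lies in \<open>P n\<close>.\<close>

lemma right_last:
  assumes "b \<in> P 1" and "n \<in> I" and "0 < n" and "n + 1 \<notin> I"
  shows "P n = {t \<in> D. Sup (P (n - 1)) \<le> t}"
proof -
  define k where "k = nat (n - 1)"
  have n: "n = int k + 1" using assms by (simp add: k_def)
  let ?y = "Sup (P (int k))"
  have e: "?y \<in> P (int k)" "?y \<in> P n" "P n \<subseteq> {?y..}"
    using right_end[OF assms(1), of k] assms n by auto
  have kI: "int k \<in> I" using convex_I[OF zero_in assms(2), of "int k"] n by auto
  obtain x where x: "P (int k) \<inter> P n = {x}" using adjacent[OF kI assms(2)] n by auto
  then have x: "P (int k) \<inter> P n = {?y}" using e by auto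
  obtain s where s: "s \<in> P (int k)" "s \<noteq> ?y" using nondegenerate[OF kI] by (metis less_irrefl)
  \<comment> \<open>\<open>Sup\<close> bounds a set of reals only if that set is bounded above, so
    this is checked separately for \<open>P 0\<close> and for the later pieces.\<close>
  have "bdd_above (P (int k))"
  proof (cases k)
    case 0 then show ?thesis by (simp add: P_zero)
  next
    case (Suc j)
    then have "P (int k) = {Sup (P (int (k-1)))..?y}" using right_end[OF assms(1), of k] assms n by auto
    then show ?thesis by (metis bdd_above_Icc)
  qed
  then have "s < ?y" using s cSup_upper by fastforce
  have sD: "s \<in> D - P n" using s x P_sub[OF kI] by auto
  have "t \<in> P n" if "t \<in> D" "?y \<le> t" for t
  proof (rule ccontr)
    assume "t \<notin> P n"
    then have "?y \<in> D - P n"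
      using mem_is_interval_1_I[OF interval_outer[OF assms(2)] sD, of t ?y] assms(4) that \<open>s < ?y\<close> by auto
    then show False using e by auto
  qed
  then show ?thesis using e P_sub[OF assms(2)] n by auto
qed

lemma right_closed:
  assumes "b \<in> P 1" and "n \<in> I" and "0 < n"
  shows "closedin (top_of_set D) (P n)"
proof (cases "n + 1 \<in> I")
  case True
  then have "compact (P n)"
    using compact_inner[of n] convex_I[OF zero_in assms(2), of "n - 1"] assms(3) by auto
  then show ?thesis
    using P_sub[OF assms(2)] by (simp add: closed_subset compact_imp_closed)
next
  case False
  then have "P n = D \<inter> {Sup (P (n - 1))..}" using right_last[OF assms False] by auto
  then show ?thesis by (auto simp: closedin_closed)
qed

lemma right_covered_below:
  assumes "b \<in> P 1" and "int k + 1 \<in> I" and "b \<le> t" and "t \<le> Sup (P (int k))"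
  shows "\<exists>n\<in>I. t \<in> P n"
  using assms(2,4)
proof (induction k)
  case 0
  then show ?case using zero_in assms(3) a_less_b by (auto simp: P_zero intro!: bexI[of _ 0])
next
  case (Suc k)
  have kI: "int k + 1 \<in> I" using convex_I[OF zero_in Suc.prems(1), of "int k + 1"] by auto
  show ?case
  proof (cases "t \<le> Sup (P (int k))")
    case True then show ?thesis using Suc.IH kI by simp
  next
    case False
    have "P (int (Suc k)) = {Sup (P (int k))..Sup (P (int (Suc k)))}"
      using right_end[OF assms(1) Suc.prems(1)] by simp
    moreover have "t \<in> {Sup (P (int k))..Sup (P (int (Suc k)))}"
      using False Suc.prems(2) by simp
    ultimately have "t \<in> P (int (Suc k))" by blast
    then show ?thesis using kI by (metis add.commute of_nat_Suc)
  qed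
qed

text \<open>If the positive indices end, the last piece takes in the rest of \<open>D\<close>.
  Otherwise the right endpoints increase to a limit not beyond the missed point \<open>t\<close>.
  The limit then lies in \<open>D\<close>, and whole pieces come arbitrarily close to it, which
  \<open>separated\<close> forbids.\<close>

lemma right_covered:
  assumes b: "b \<in> P 1" and t: "t \<in> D" "b \<le> t"
  shows "\<exists>n\<in>I. t \<in> P n"
proof (cases "\<forall>k::nat. int k + 1 \<in> I")
  case False
  then have ex: "\<exists>k::nat. int k + 1 \<notin> I" by blast
  \<comment> \<open>As \<open>1 \<in> I\<close>, this \<open>m\<close> is a successor
    \<open>Suc k\<close>, and \<open>int k + 1\<close> is the largest index.\<close>
  define m where "m = (LEAST k::nat. int k + 1 \<notin> I)"
  have m: "int m + 1 \<notin> I" and least: "\<And>j. j < m \<Longrightarrow> int j + 1 \<in> I"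
    unfolding m_def using LeastI_ex[OF ex] not_less_Least by blast+
  have "m \<noteq> 0" using m one_in by (metis add_0 of_nat_0)
  then obtain k where k: "m = Suc k" using not0_implies_Suc by blast
  have kI: "int k + 1 \<in> I" using least[of k] k by simp
  have "int k + 1 + 1 \<notin> I" using m k by (simp add: add.commute)
  then have "P (int k + 1) = {t \<in> D. Sup (P (int k)) \<le> t}"
    using right_last[OF b kI] by simp
  then show ?thesis
    using right_covered_below[OF b kI t(2)] t kI by (cases "t \<le> Sup (P (int k))") auto
next
  case True
  define y where "y k = Sup (P (int k))" for k :: nat
  have seg: "P (int (Suc k)) = {y k..y (Suc k)}" "b \<le> y k" for k
    using right_end[OF b, of "Suc k"] right_end[OF b, of k] True[rule_format, of "Suc k"]
      True[rule_format, of k] by (auto simp: y_def)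
  have y_less: "y k < y (Suc k)" for k
    using nondegenerate[of "int (Suc k)"] seg(1)[of k] True[rule_format, of k] by (auto simp: add.commute)
  show ?thesis
  proof (rule ccontr)
    assume none: "\<not> ?thesis"
    then have above: "y k < t" for k
      using right_covered_below[OF b True[rule_format, of k] t(2)] by (force simp: y_def)
    have inc: "incseq y" using y_less by (simp add: incseq_SucI less_imp_le)
    have "bdd_above (range y)" using above by (meson bdd_aboveI2 less_imp_le)
    then have lim: "y \<longlonglongrightarrow> (SUP k. y k)" using inc by (rule LIMSEQ_incseq_SUP)
    define x where "x = (SUP k. y k)"
    have yx: "y k \<le> x" for k using \<open>bdd_above (range y)\<close> by (simp add: cSUP_upper x_def)
    have "x \<le> t" unfolding x_def using above by (intro cSUP_least) (auto intro: less_imp_le)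
    \<comment> \<open>Strictness matters: \<open>separated\<close> speaks only of points outside
      \<open>P 0\<close>, which ends at \<open>b\<close>.\<close>
    have "b < x" using y_less[of 0] seg(2)[of 0] yx[of "Suc 0"] by linarith
    have "b \<in> D" using b P_sub[OF one_in] by auto
    then have "x \<in> D"
      using mem_is_interval_1_I[OF interval_D _ t(1), of b x] \<open>b < x\<close> \<open>x \<le> t\<close> by auto
    moreover have "x \<notin> P 0" using \<open>b < x\<close> by (simp add: P_zero)
    ultimately obtain e where e: "e > 0" "\<And>n. n - 1 \<in> I \<Longrightarrow> n + 1 \<in> I \<Longrightarrow> \<exists>s\<in>P n. e \<le> \<bar>s - x\<bar>"
      using separated by blast
    obtain N where N: "\<And>k. k \<ge> N \<Longrightarrow> \<bar>y k - x\<bar> < e"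
      using LIMSEQ_D[OF lim e(1)] by (auto simp: x_def)
    \<comment> \<open>The index is \<open>Suc N\<close> because that piece runs from
      \<open>y N\<close> to \<open>y (Suc N)\<close>; it lies within \<open>e\<close> of
      \<open>x\<close> since \<open>y N\<close> does and \<open>y (Suc N) \<le> x\<close>.\<close>
    have "int (Suc N) - 1 \<in> I"
      using True[rule_format, of N] convex_I[OF zero_in, of "int N + 1" "int N"] by auto
    moreover have "int (Suc N) + 1 \<in> I" using True[rule_format, of "Suc N"] by simp
    ultimately obtain s where "s \<in> P (int (Suc N))" "e \<le> \<bar>s - x\<bar>"
      using e(2) by blast
    then show False using seg(1)[of N] N[of N] yx[of "Suc N"] by auto
  qed
qed

section \<open>Reversing the indices and reflecting the line\<close>

lemma flip: "interval_chain D (\<lambda>n. P (- n)) {n. - n \<in> I} a b"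
proof
  fix p q r assume "p \<in> {n. - n \<in> I}" "q \<in> {n. - n \<in> I}" "p \<le> r" "r \<le> q"
  then show "r \<in> {n. - n \<in> I}" using convex_I[of "- q" "- p" "- r"] by auto
next
  fix n assume "n - 1 \<in> {n. - n \<in> I}" "n + 1 \<in> {n. - n \<in> I}"
  moreover have "- (n + 1) = - n - 1" "- (n - 1) = - n + 1" by simp_all
  ultimately have "- n - 1 \<in> I" "- n + 1 \<in> I" by (metis mem_Collect_eq)+
  then show "compact (P (- n))" by (rule compact_inner)
next
  fix n assume "n \<in> {n. - n \<in> I}" "n - 1 \<notin> {n. - n \<in> I} \<or> n + 1 \<notin> {n. - n \<in> I}"
  moreover have "- (n + 1) = - n - 1" "- (n - 1) = - n + 1" by simp_all
  ultimately have "- n \<in> I" "- n - 1 \<notin> I \<or> - n + 1 \<notin> I" by (metis mem_Collect_eq)+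
  then show "is_interval (D - P (- n))" by (rule interval_outer)
next
  fix p q assume "p \<in> {n. - n \<in> I}" "q \<in> {n. - n \<in> I}" "\<bar>p - q\<bar> = 1"
  then show "\<exists>x. P (- p) \<inter> P (- q) = {x} \<and> x \<notin> interior (P (- p))"
    using adjacent[of "- p" "- q"] by auto
next
  fix p q assume "p \<in> {n. - n \<in> I}" "q \<in> {n. - n \<in> I}" "\<bar>p - q\<bar> \<ge> 2"
  then show "P (- p) \<inter> P (- q) = {}"
    using apart[of "- p" "- q"] by auto
next
  fix t assume "t \<in> D" "t \<notin> P (- 0)"
  then obtain e where e: "e>0" "\<And>n. n - 1 \<in> I \<Longrightarrow> n + 1 \<in> I \<Longrightarrow> \<exists>s\<in>P n. e \<le> \<bar>s - t\<bar>"
    using separated[of t] by auto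
  have "\<exists>s\<in>P (- n). e \<le> \<bar>s - t\<bar>" if "n - 1 \<in> {n. - n \<in> I}" "n + 1 \<in> {n. - n \<in> I}" for n
  proof (rule e(2))
    have "- (n + 1) = - n - 1" "- (n - 1) = - n + 1" by simp_all
    then show "- n - 1 \<in> I" "- n + 1 \<in> I" using that by (metis mem_Collect_eq)+
  qed
  then show "\<exists>e>0. \<forall>n. n - 1 \<in> {n. - n \<in> I} \<longrightarrow> n + 1 \<in> {n. - n \<in> I} \<longrightarrow> (\<exists>s\<in>P (- n). e \<le> \<bar>s - t\<bar>)"
    using e(1) by blast
qed (use interval_D one_in neg_one_in interval_P P_sub nondegenerate P_zero in auto)

text \<open>Combined with \<open>flip\<close>, this turns the pieces left of \<open>a\<close> into
  pieces of positive index right of \<open>- a\<close>, so only the right half of a chain has to be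
  studied.\<close>

lemma mirror: "interval_chain (uminus ` D) (\<lambda>n. uminus ` P n) I (- b) (- a)"
proof
  fix n assume "n - 1 \<in> I" "n + 1 \<in> I"
  then show "compact (uminus ` P n)"
    using compact_inner[of n] by (simp add: compact_continuous_image continuous_on_minus)
next
  fix n assume "n \<in> I" "n - 1 \<notin> I \<or> n + 1 \<notin> I"
  moreover have "uminus ` D - uminus ` P n = uminus ` (D - P n)"
    by (rule image_set_diff[symmetric]) auto
  ultimately show "is_interval (uminus ` D - uminus ` P n)"
    using interval_outer[of n] by simp
next
  fix p q assume "p \<in> I" "q \<in> I" "\<bar>p - q\<bar> = 1"
  then obtain x where x: "P p \<inter> P q = {x}" "x \<notin> interior (P p)"
    using adjacent by blast
  have "uminus ` P p \<inter> uminus ` P q = uminus ` (P p \<inter> P q)"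
    by (rule image_Int[symmetric]) auto
  moreover have "- x \<notin> interior (uminus ` P p)"
    using x(2) by (auto simp: interior_negations)
  ultimately show "\<exists>x. uminus ` P p \<inter> uminus ` P q = {x} \<and> x \<notin> interior (uminus ` P p)"
    using x(1) by auto
next
  fix p q assume "p \<in> I" "q \<in> I" "\<bar>p - q\<bar> \<ge> 2"
  then show "uminus ` P p \<inter> uminus ` P q = {}"
    using apart by fastforce
next
  fix t assume "t \<in> uminus ` D" "t \<notin> uminus ` P 0"
  then have "- t \<in> D" "- t \<notin> P 0" by force+
  then obtain e where e: "e>0" "\<And>n. n - 1 \<in> I \<Longrightarrow> n + 1 \<in> I \<Longrightarrow> \<exists>s\<in>P n. e \<le> \<bar>s - - t\<bar>"
    using separated[of "- t"] by blast
  have "\<exists>s\<in>uminus ` P n. e \<le> \<bar>s - t\<bar>" if I: "n - 1 \<in> I" "n + 1 \<in> I" for n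
  proof -
    obtain s where "s \<in> P n" "e \<le> \<bar>s - - t\<bar>" using e(2)[OF I] by blast
    moreover have "\<bar>s - - t\<bar> = \<bar>- s - t\<bar>" by linarith
    ultimately show ?thesis by auto
  qed
  then show "\<exists>e>0. \<forall>n. n - 1 \<in> I \<longrightarrow> n + 1 \<in> I \<longrightarrow> (\<exists>s\<in>uminus ` P n. e \<le> \<bar>s - t\<bar>)"
    using e(1) by blast
next
  fix p q r assume "p \<in> I" "q \<in> I" "p \<le> r" "r \<le> q"
  then show "r \<in> I" by (rule convex_I)
next
  fix n assume "n \<in> I"
  then obtain x y where "x \<in> P n" "y \<in> P n" "x < y" using nondegenerate by blast
  then show "\<exists>x\<in>uminus ` P n. \<exists>y\<in>uminus ` P n. x < y"
    by (intro bexI[of _ "- y"] bexI[of _ "- x"]) auto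
qed (use interval_D one_in neg_one_in interval_P P_sub P_zero in \<open>auto simp: image_mono\<close>)

section \<open>Order, covering and closedness for either orientation\<close>

lemma end_cases:
  obtains "b \<in> P 1" "a \<in> P (- 1)" | "a \<in> P 1" "b \<in> P (- 1)"
proof -
  obtain x where x: "P 0 \<inter> P 1 = {x}" "x \<notin> interior (P 0)"
    using adjacent[OF zero_in one_in] by auto
  obtain y where y: "P 0 \<inter> P (- 1) = {y}" "y \<notin> interior (P 0)"
    using adjacent[OF zero_in neg_one_in] by auto
  \<comment> \<open>The two neighbours of \<open>P 0\<close> are apart, so they touch it in
    different endpoints.\<close>
  have "P 1 \<inter> P (- 1) = {}" using apart[OF one_in neg_one_in] by simp
  then have "x \<noteq> y" using x y by blast
  moreover have "x \<in> {a..b}" "y \<in> {a..b}" using x(1) y(1) P_zero by blast+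
  ultimately have "x = a \<and> y = b \<or> x = b \<and> y = a"
    using x(2) y(2) by (auto simp: P_zero interior_atLeastAtMost_real)
  then show thesis using x(1) y(1) that by blast
qed

text \<open>Positive indices are handled directly. Negative ones follow from the same lemmas for the
  chain with reversed indices on the reflected line, where \<open>- a\<close> plays the role of
  \<open>b\<close>.\<close>

lemma oriented_cover_closed_between:
  assumes b: "b \<in> P 1" and a: "a \<in> P (- 1)"
  shows "D \<subseteq> (\<Union>n\<in>I. P n)"
    and "n \<in> I \<Longrightarrow> closedin (top_of_set D) (P n)"
    and "p \<in> I \<Longrightarrow> q \<in> I \<Longrightarrow> p < 0 \<Longrightarrow> 0 < q \<Longrightarrow> s \<in> P p \<Longrightarrow> t \<in> P q \<Longrightarrow> P 0 \<subseteq> {s..t}"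
proof -
  interpret flip: interval_chain D "\<lambda>n. P (- n)" "{n. - n \<in> I}" a b by (rule flip)
  interpret mir: interval_chain "uminus ` D" "\<lambda>n. uminus ` P (- n)" "{n. - n \<in> I}" "- b" "- a"
    by (rule flip.mirror)
  have ma: "- a \<in> uminus ` P (- 1)" using a by simp
  show "D \<subseteq> (\<Union>n\<in>I. P n)"
  proof
    fix t assume t: "t \<in> D"
    consider "b \<le> t" | "t \<in> {a..b}" | "- a \<le> - t" by fastforce
    then show "t \<in> (\<Union>n\<in>I. P n)"
    proof cases
      case 1 then show ?thesis using right_covered[OF b t] by auto
    next
      case 2 then show ?thesis using zero_in P_zero by auto
    next
      case 3
      then obtain n where "- n \<in> I" "- t \<in> uminus ` P (- n)"
        using mir.right_covered[OF ma, of "- t"] t by auto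
      then show ?thesis by auto
    qed
  qed
  show "closedin (top_of_set D) (P n)" if n: "n \<in> I" for n
  proof -
    consider "n > 0" | "n = 0" | "n < 0" by linarith
    then show ?thesis
    proof cases
      case 1 then show ?thesis using right_closed[OF b n] by simp
    next
      case 2 then show ?thesis using P_sub[OF zero_in] P_zero by (simp add: closed_subset)
    next
      case 3
      then have "closedin (top_of_set (uminus ` D)) (uminus ` P n)"
        using mir.right_closed[OF ma, of "- n"] n by simp
      then obtain C where C: "closed C" "uminus ` P n = uminus ` D \<inter> C"
        by (auto simp: closedin_closed)
      have "P n = uminus ` uminus ` P n" by (simp add: image_image)
      also have "\<dots> = D \<inter> uminus ` C" by (auto simp: C(2) image_iff) force
      finally show ?thesis using closed_negations[OF C(1)] by (auto simp: closedin_closed)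
    qed
  qed
  assume pq: "p \<in> I" "q \<in> I" "p < 0" "0 < q" "s \<in> P p" "t \<in> P q"
  have "b \<le> t" using right_sub[OF b pq(2,4)] pq by auto
  moreover have "- a \<le> - s" using mir.right_sub[OF ma, of "- p"] pq by auto
  ultimately show "P 0 \<subseteq> {s..t}" by (auto simp: P_zero)
qed

text \<open>In the second orientation, \<open>flip\<close> alone exchanges the roles of
  \<open>P 1\<close> and \<open>P (- 1)\<close> and keeps every piece as a set.\<close>

lemma cover: "D \<subseteq> (\<Union>n\<in>I. P n)"
proof (cases rule: end_cases)
  case 1 then show ?thesis by (rule oriented_cover_closed_between)
next
  case 2
  interpret flip: interval_chain D "\<lambda>n. P (- n)" "{n. - n \<in> I}" a b by (rule flip)
  show ?thesis using flip.oriented_cover_closed_between(1) 2 by fastforce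
qed

lemma closedin_P:
  assumes "n \<in> I" shows "closedin (top_of_set D) (P n)"
proof (cases rule: end_cases)
  case 1 then show ?thesis using assms by (rule oriented_cover_closed_between)
next
  case 2
  interpret flip: interval_chain D "\<lambda>n. P (- n)" "{n. - n \<in> I}" a b by (rule flip)
  show ?thesis using flip.oriented_cover_closed_between(2)[of "- n"] 2 assms by simp
qed

text \<open>This is what prevents a connected set from meeting both extremal pieces while avoiding
  \<open>P 0\<close>.\<close>

lemma between:
  assumes "p \<in> I" "q \<in> I" "p < 0" "0 < q" "s \<in> P p" "t \<in> P q"
    and B: "is_interval B" "s \<in> B" "t \<in> B"
  shows "P 0 \<subseteq> B"
proof (cases rule: end_cases)
  case 1
  then have "P 0 \<subseteq> {s..t}" using assms by (intro oriented_cover_closed_between(3))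
  then show ?thesis using mem_is_interval_1_I[OF B] by fastforce
next
  case 2
  interpret flip: interval_chain D "\<lambda>n. P (- n)" "{n. - n \<in> I}" a b by (rule flip)
  have "P 0 \<subseteq> {t..s}"
    using flip.oriented_cover_closed_between(3)[of "- q" "- p" t s] 2 assms by simp
  then show ?thesis using mem_is_interval_1_I[OF B(1,3,2)] by fastforce
qed

text \<open>The point \<open>t\<close> may be an endpoint of the piece: a small move from
  \<open>t\<close> towards another point \<open>u\<close> of the piece leads into its interior
  without leaving \<open>B\<close>.\<close>

lemma interior_nonempty:
  assumes "n \<in> I" and "t \<in> P n" and "openin (top_of_set D) B" and "t \<in> B"
  shows "B \<inter> interior (P n) \<noteq> {}"
proof -
  obtain e where e: "e > 0" "ball t e \<inter> D \<subseteq> B"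
    using assms(3,4) by (metis openin_contains_ball)
  obtain x y where xy: "x \<in> P n" "y \<in> P n" "x < y" using nondegenerate[OF assms(1)] by blast
  obtain u where u: "u \<in> P n" "u \<noteq> t" using xy by (metis less_irrefl)
  define l r where "l = min t u" and "r = max t u"
  have lr: "l < r" "l \<in> P n" "r \<in> P n" using u assms(2) by (auto simp: l_def r_def min_def max_def)
  have "{l..r} \<subseteq> P n" using mem_is_interval_1_I[OF interval_P[OF assms(1)] lr(2,3)] by auto
  then have sub: "{l<..<r} \<subseteq> interior (P n)"
    by (intro interior_maximal) (auto simp: subset_iff)
  \<comment> \<open>A step shorter than \<open>e\<close> stays in the ball, and one shorter than the
    distance from \<open>t\<close> to \<open>u\<close> stays strictly between them.\<close>
  define \<delta> where "\<delta> = min (e / 2) (\<bar>u - t\<bar> / 2)"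
  have \<delta>: "0 < \<delta>" "\<delta> < e" "\<delta> < \<bar>u - t\<bar>" using e(1) u(2) by (auto simp: \<delta>_def min_def)
  define z where "z = (if t < u then t + \<delta> else t - \<delta>)"
  have "z \<in> {l<..<r}" "z \<in> ball t e"
    using \<delta> u(2) by (auto simp: z_def dist_real_def l_def r_def)
  then show ?thesis
    using sub e(2) P_sub[OF assms(1)] interior_subset[of "P n"] by blast
qed

end

section \<open>Automorphisms of a path\<close>

text \<open>The walk never turns back: \<open>\<sigma> m\<close> is a neighbour of
  \<open>\<sigma> (m - 1)\<close>, and one of the two neighbours is already taken by
  \<open>\<sigma> (m - 2)\<close>.\<close>

lemma path_automorphism_pos:
  fixes \<sigma> :: "int \<Rightarrow> int"
  assumes inj: "inj_on \<sigma> I" and conv: "\<And>n. 0 \<le> n \<Longrightarrow> n \<le> m \<Longrightarrow> n \<in> I"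
    and adj: "\<And>p q. p \<in> I \<Longrightarrow> q \<in> I \<Longrightarrow> \<bar>p - q\<bar> = 1 \<Longrightarrow> \<bar>\<sigma> p - \<sigma> q\<bar> = 1"
    and \<sigma>: "\<sigma> 0 = 0" "\<sigma> 1 = s" and m: "0 \<le> m"
  shows "\<sigma> m = s * m"
  using conv m
proof (induction "nat m" arbitrary: m rule: less_induct)
  case less
  consider "m = 0" | "m = 1" | "m \<ge> 2" using less.prems(2) by linarith
  then show ?case
  proof cases
    case 3
    have mem: "m \<in> I" "m - 1 \<in> I" "m - 2 \<in> I" using less.prems 3 by auto
    have IH: "\<sigma> (m - 1) = s * (m - 1)" "\<sigma> (m - 2) = s * (m - 2)"
      using less.hyps[of "m - 1"] less.hyps[of "m - 2"] less.prems 3 by auto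
    have "\<bar>s\<bar> = 1" using adj[of 1 0] \<sigma> less.prems 3 by auto
    then have "s = 1 \<or> s = -1" by linarith
    moreover have "\<bar>\<sigma> m - \<sigma> (m - 1)\<bar> = 1" by (rule adj[OF mem(1,2)]) simp
    moreover have "\<sigma> m \<noteq> \<sigma> (m - 2)" using inj mem by (auto dest: inj_onD)
    ultimately show ?thesis using IH by auto
  qed (use \<sigma> in auto)
qed

text \<open>The negative side of \<open>\<sigma>\<close> is the positive side of
  \<open>\<lambda>n. \<sigma> (- n)\<close>. Injectivity makes the two sides leave \<open>0\<close>
  in opposite directions, so one sign serves for both.\<close>

lemma path_automorphism:
  fixes \<sigma> :: "int \<Rightarrow> int"
  assumes inj: "inj_on \<sigma> I" and one: "1 \<in> I" "-1 \<in> I"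
    and conv: "\<And>p q r. p \<in> I \<Longrightarrow> q \<in> I \<Longrightarrow> p \<le> r \<Longrightarrow> r \<le> q \<Longrightarrow> r \<in> I"
    and adj: "\<And>p q. p \<in> I \<Longrightarrow> q \<in> I \<Longrightarrow> \<bar>p - q\<bar> = 1 \<Longrightarrow> \<bar>\<sigma> p - \<sigma> q\<bar> = 1"
    and zero: "\<sigma> 0 = 0"
  shows "(\<forall>m\<in>I. \<sigma> m = m) \<or> (\<forall>m\<in>I. \<sigma> m = - m)"
proof -
  have z: "0 \<in> I" using conv[OF one(2,1), of 0] by simp
  have pos: "\<sigma> m = \<sigma> 1 * m" if "m \<in> I" "0 \<le> m" for m
    using that conv[OF z] by (intro path_automorphism_pos[OF inj _ adj zero refl]) auto
  have neg: "\<sigma> m = - \<sigma> (- 1) * m" if "m \<in> I" "m \<le> 0" for m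
  proof -
    have "(\<lambda>n. \<sigma> (- n)) (- m) = \<sigma> (- 1) * (- m)"
    proof (rule path_automorphism_pos[where I = "uminus ` I"])
      show "inj_on (\<lambda>n. \<sigma> (- n)) (uminus ` I)"
        using inj by (auto simp: inj_on_def)
      fix p q assume "p \<in> uminus ` I" "q \<in> uminus ` I" "\<bar>p - q\<bar> = 1"
      then show "\<bar>\<sigma> (- p) - \<sigma> (- q)\<bar> = 1" using adj[of "- p" "- q"] by auto
    next
      fix n assume "0 \<le> n" "n \<le> - m"
      then have "- n \<in> I" using conv[OF that(1) z, of "- n"] by simp
      then show "n \<in> uminus ` I" by (metis image_eqI minus_minus)
    qed (use that zero in auto)
    then show ?thesis by simp
  qed
  have "\<bar>\<sigma> 1\<bar> = 1" "\<bar>\<sigma> (- 1)\<bar> = 1" using adj[OF one(1) z] adj[OF one(2) z] zero by auto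
  moreover have "\<sigma> 1 \<noteq> \<sigma> (- 1)" using inj one by (auto dest: inj_onD)
  ultimately have "\<sigma> (- 1) = - \<sigma> 1" "\<sigma> 1 = 1 \<or> \<sigma> 1 = - 1" by linarith+
  moreover have "\<sigma> m = \<sigma> 1 * m" if "m \<in> I" for m
    using pos[of m] neg[of m] that \<open>\<sigma> (- 1) = - \<sigma> 1\<close> by (cases "0 \<le> m") auto
  ultimately show ?thesis by auto
qed

lemma embedding_map_subset:
  assumes "embedding_map (subtopology X A) Y f" and "B \<subseteq> A"
  shows "embedding_map (subtopology X B) Y f"
proof -
  have "subtopology (subtopology X A) B = subtopology X B"
    using assms(2) by (simp add: subtopology_subtopology Int_absorb1)
  moreover have "embedding_map (subtopology (subtopology X A) B) (subtopology X A) id"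
    by (simp add: embedding_map_def homeomorphic_map_id topspace_subtopology_subset)
       (metis Int_commute subtopology_restrict topspace_subtopology)
  ultimately have "embedding_map (subtopology X B) (subtopology X A) id" by simp
  from embedding_map_compose[OF this assms(1)] show ?thesis by simp
qed

section \<open>Decompositions of free curves\<close>

text \<open>
  \<open>f\<close> is the parametrized curve, \<open>{a..b}\<close> corresponds to \<open>\<Sigma>\<close>, and \<open>K\<close> to \<open>G\<^sub>S\<close>. The last assumption
  is all that is needed of non-contractivity.
\<close>

locale free_curve = group_action G "topspace M" \<phi>
  for G (structure) and M :: "'m topology" and \<phi> +
  fixes f :: "real \<Rightarrow> 'm" and D :: "real set" and a b :: real and K :: "'a set"
  assumes continuous_action: "g \<in> carrier G \<Longrightarrow> continuous_map M M (\<phi> g)"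
    and interval_D: "is_interval D"
    and inj_f: "inj_on f D"
    and f_D: "f ` D \<subseteq> topspace M"
    and K_subgroup: "subgroup K G"
    and K_fixes: "g \<in> K \<Longrightarrow> t \<in> D \<Longrightarrow> \<phi> g (f t) = f t"
    and segment_sub: "{a..b} \<subseteq> D"
    and embedding_segment: "embedding_map (top_of_set {a..b}) M f"
    and free: "g \<in> carrier G \<Longrightarrow> A \<subseteq> {a..b} \<Longrightarrow> B \<subseteq> {a..b} \<Longrightarrow> open A \<Longrightarrow> open B \<Longrightarrow>
      connected A \<Longrightarrow> connected B \<Longrightarrow> A \<noteq> {} \<Longrightarrow> B \<noteq> {} \<Longrightarrow> \<phi> g ` f ` A = f ` B \<Longrightarrow> g \<in> K"
    and translates_separated: "t \<in> D \<Longrightarrow> t \<notin> {a..b} \<Longrightarrow>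
      \<exists>e>0. \<forall>g\<in>carrier G. \<forall>Y\<subseteq>D. \<phi> g ` f ` {a..b} = f ` Y \<longrightarrow> (\<exists>s\<in>Y. e \<le> \<bar>s - t\<bar>)"
begin

section \<open>Cosets and changes of parameter\<close>

lemma group_G: "group G"
  using group_hom group_hom.axioms(1) by blast

lemma coset_eqI:
  assumes "g \<in> carrier G" "h \<in> carrier G" "inv h \<otimes> g \<in> K"
  shows "g <# K = h <# K"
proof -
  interpret group G by (rule group_G)
  have "g = h \<otimes> (inv h \<otimes> g)" using assms by (simp add: m_assoc[symmetric])
  then have "g \<in> h <# K" using assms(3) unfolding l_coset_def by blast
  then show ?thesis using l_repr_independence[OF _ assms(2) K_subgroup] by simp
qed

lemma coset_eqD:
  assumes "g \<in> carrier G" "h \<in> carrier G" "g <# K = h <# K" "t \<in> D"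
  shows "\<phi> g (f t) = \<phi> h (f t)"
proof -
  interpret group G by (rule group_G)
  have "g \<in> h <# K" using lcos_self[OF assms(1) K_subgroup] assms(3) by simp
  then obtain k where k: "k \<in> K" "g = h \<otimes> k" by (auto simp: l_coset_def)
  have "f t \<in> topspace M" "k \<in> carrier G"
    using f_D assms(4) k(1) subgroup.subset[OF K_subgroup] by auto
  then show ?thesis using composition_rule[of "f t" h k] k K_fixes assms by simp
qed

lemma inverse_image:
  assumes g: "g \<in> carrier G" and X: "X \<subseteq> D" and eq: "\<phi> g ` f ` X = f ` Y"
  shows "\<phi> (inv g) ` f ` Y = f ` X"
proof -
  have "\<phi> (inv g) (\<phi> g (f t)) = f t" if "t \<in> X" for t
    using that X f_D by (intro orbit_sym_aux[OF g]) auto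
  then show ?thesis unfolding eq[symmetric] by (auto simp: image_iff)
qed

text \<open>The map \<open>h\<close> is the inverse of \<open>f\<close> on the image of
  \<open>Y\<close>, after \<open>\<phi> g\<close>, after \<open>f\<close>; the embedding on
  \<open>Y\<close> makes that inverse continuous. Translations of the curve thereby become maps
  between sets of reals.\<close>

lemma transition:
  assumes g: "g \<in> carrier G" and X: "X \<subseteq> D" and Y: "Y \<subseteq> D"
    and "embedding_map (top_of_set X) M f" "embedding_map (top_of_set Y) M f"
    and eq: "\<phi> g ` f ` X = f ` Y"
  obtains h where "continuous_on X h" "inj_on h X" "h ` X = Y" "\<And>t. t \<in> X \<Longrightarrow> f (h t) = \<phi> g (f t)"
proof -
  have hX: "homeomorphic_map (top_of_set X) (subtopology M (f ` X)) f"
    and hY: "homeomorphic_map (top_of_set Y) (subtopology M (f ` Y)) f"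
    using assms by (auto simp: embedding_map_def)
  obtain k where k: "homeomorphic_maps (top_of_set Y) (subtopology M (f ` Y)) f k"
    using hY homeomorphic_map_maps by blast
  have fX: "continuous_map (top_of_set X) (subtopology M (f ` X)) f"
    using hX homeomorphic_imp_continuous_map by blast
  have \<phi>g: "continuous_map (subtopology M (f ` X)) (subtopology M (f ` Y)) (\<phi> g)"
    using continuous_action[OF g] eq
    by (auto simp: continuous_map_in_subtopology continuous_map_from_subtopology)
  have "continuous_map (subtopology M (f ` Y)) (top_of_set Y) k"
    using k by (simp add: homeomorphic_maps_def)
  note continuous_map_compose[OF continuous_map_compose[OF fX \<phi>g] this]
  then have cont: "continuous_on X (\<lambda>t. k (\<phi> g (f t)))"
    by (simp add: o_def)
  have kf: "k (f s) = s" if "s \<in> Y" for s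
    using k that by (simp add: homeomorphic_maps_def)
  have fk: "f (k (\<phi> g (f t))) = \<phi> g (f t)" if "t \<in> X" for t
  proof -
    have "\<phi> g (f t) \<in> f ` Y" using eq that by blast
    then show ?thesis using kf by auto
  qed
  have "s = t" if "s \<in> X" "t \<in> X" "k (\<phi> g (f s)) = k (\<phi> g (f t))" for s t
  proof -
    have "\<phi> g (f s) = \<phi> g (f t)" 
      using arg_cong[OF that(3), of f] unfolding fk[OF that(1)] fk[OF that(2)] .
    moreover have "s \<in> D" "t \<in> D" using that X by blast+
    moreover from this have "f s \<in> topspace M" "f t \<in> topspace M" using f_D by blast+
    ultimately show ?thesis using inj_onD[OF inj_prop[OF g]] inj_onD[OF inj_f] by blast
  qed
  then have "inj_on (\<lambda>t. k (\<phi> g (f t))) X" by (rule inj_onI)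
  moreover have "(\<lambda>t. k (\<phi> g (f t))) ` X = k ` f ` Y"
    unfolding eq[symmetric] by (simp add: image_image)
  moreover have "k ` f ` Y = Y" using kf by (simp add: image_image)
  ultimately show thesis using that[OF cont _ _ fk] by simp
qed

text \<open>The change of parameter belonging to \<open>inv g\<close> is a continuous injection on
  the open set \<open>B\<close> of reals, so its image is open by invariance of domain.\<close>

lemma pull_back_open:
  assumes g: "g \<in> carrier G" and X: "X \<subseteq> D" and Y: "Y \<subseteq> D"
    and emb: "embedding_map (top_of_set X) M f" "embedding_map (top_of_set Y) M f"
    and eq: "\<phi> g ` f ` X = f ` Y"
    and B: "B \<subseteq> Y" "open B" "connected B" "B \<noteq> {}"
  obtains A where "A \<subseteq> X" "open A" "connected A" "A \<noteq> {}" "\<phi> g ` f ` A = f ` B"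
proof -
  interpret group G by (rule group_G)
  obtain h where h: "continuous_on Y h" "inj_on h Y" "h ` Y = X"
      and fh: "\<And>t. t \<in> Y \<Longrightarrow> f (h t) = \<phi> (inv g) (f t)"
    using transition[OF inv_closed[OF g] Y X emb(2,1) inverse_image[OF g X eq]] by blast
  have hB: "continuous_on B h" "inj_on h B"
    using h B(1) continuous_on_subset inj_on_subset by blast+
  have "f ` h ` B = \<phi> (inv g) ` f ` B"
    unfolding image_image using fh B(1) by (intro image_cong refl) auto
  then have "\<phi> (inv (inv g)) ` f ` h ` B = f ` B"
    using inverse_image[OF inv_closed[OF g], of B "h ` B"] B(1) Y by auto
  then have "\<phi> g ` f ` h ` B = f ` B" using g by simp
  moreover have "open (h ` B)" using invariance_of_domain[OF hB(1) B(2) hB(2)] .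
  moreover have "connected (h ` B)" using connected_continuous_image[OF hB(1) B(3)] .
  moreover have "h ` B \<subseteq> X" using h B by auto
  ultimately show thesis using that B(4) by blast
qed

text \<open>The element \<open>inv h \<otimes> g\<close> carries the image of \<open>A\<close> onto
  that of \<open>A'\<close>, both open parts of the free segment, so it lies in
  \<open>K\<close>.\<close>

lemma same_coset:
  assumes "g \<in> carrier G" "h \<in> carrier G"
    and A: "A \<subseteq> {a..b}" "open A" "connected A" "A \<noteq> {}" "\<phi> g ` f ` A = f ` B"
    and A': "A' \<subseteq> {a..b}" "open A'" "connected A'" "A' \<noteq> {}" "\<phi> h ` f ` A' = f ` B"
  shows "g <# K = h <# K"
proof (rule coset_eqI[OF assms(1,2)])
  interpret group G by (rule group_G)
  have "\<phi> (inv h \<otimes> g) ` f ` A = (\<lambda>x. \<phi> (inv h) (\<phi> g x)) ` f ` A"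
    using A(1) segment_sub f_D assms(1,2)
    by (intro image_cong refl composition_rule) auto
  also have "\<dots> = \<phi> (inv h) ` f ` B" unfolding A(5)[symmetric] by (simp add: image_image)
  also have "\<dots> = f ` A'" using inverse_image[OF assms(2) _ A'(5)] A'(1) segment_sub by blast
  finally show "inv h \<otimes> g \<in> K"
    using free[of "inv h \<otimes> g" A A'] A A' assms by simp
qed

end

text \<open>A decomposition read on the parameter line, with \<open>K\<close> in the role of the
  stabilizer of the curve. In \<open>translate\<close> the set \<open>Q\<close> treats both kinds of
  index at once: it is all of \<open>{a..b}\<close> at inner indices and some subset at extremal
  ones.\<close>

locale free_curve_decomposition = free_curve G M \<phi> f D a b K
  for G (structure) and M :: "'m topology" and \<phi> f D a b K +
  fixes P :: "int \<Rightarrow> real set" and I :: "int set" and c :: "int \<Rightarrow> 'a set"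
  assumes one_in: "1 \<in> I" and neg_one_in: "-1 \<in> I"
    and convex_I: "p \<in> I \<Longrightarrow> q \<in> I \<Longrightarrow> p \<le> r \<Longrightarrow> r \<le> q \<Longrightarrow> r \<in> I"
    and interval_P: "n \<in> I \<Longrightarrow> is_interval (P n)"
    and P_sub: "n \<in> I \<Longrightarrow> P n \<subseteq> D"
    and nondegenerate: "n \<in> I \<Longrightarrow> \<exists>x\<in>P n. \<exists>y\<in>P n. x < y"
    and embedding_P: "n \<in> I \<Longrightarrow> embedding_map (top_of_set (P n)) M f"
    and interval_outer: "n \<in> I \<Longrightarrow> n - 1 \<notin> I \<or> n + 1 \<notin> I \<Longrightarrow> is_interval (D - P n)"
    and adjacent: "p \<in> I \<Longrightarrow> q \<in> I \<Longrightarrow> \<bar>p - q\<bar> = 1 \<Longrightarrow> \<exists>x. P p \<inter> P q = {x} \<and> x \<notin> interior (P p)"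
    and apart: "p \<in> I \<Longrightarrow> q \<in> I \<Longrightarrow> \<bar>p - q\<bar> \<ge> 2 \<Longrightarrow> P p \<inter> P q = {}"
    and P_zero: "P 0 = {a..b}"
    and translate: "n \<in> I \<Longrightarrow> \<exists>g\<in>carrier G. \<exists>Q\<subseteq>{a..b}. c n = g <# K \<and> \<phi> g ` f ` Q = f ` P n \<and>
      (n - 1 \<in> I \<and> n + 1 \<in> I \<longrightarrow> Q = {a..b})"
begin

lemma translate_inner:
  assumes "n - 1 \<in> I" and "n + 1 \<in> I"
  shows "n \<in> I" and "\<exists>g\<in>carrier G. c n = g <# K \<and> \<phi> g ` f ` {a..b} = f ` P n"
  using convex_I[OF assms, of n] translate[of n] assms by auto

text \<open>An inner piece is compact because a change of parameter presents it as a continuous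
  image of \<open>{a..b}\<close>. The separation property is \<open>translates_separated\<close>
  with \<open>Y = P n\<close>.\<close>

sublocale interval_chain D P I a b
proof
  fix n assume n: "n - 1 \<in> I" "n + 1 \<in> I"
  obtain g where "g \<in> carrier G" "\<phi> g ` f ` {a..b} = f ` P n"
    using translate_inner[OF n] by blast
  then obtain h where "continuous_on {a..b} h" "h ` {a..b} = P n"
    using transition[OF _ segment_sub P_sub[OF translate_inner(1)[OF n]] embedding_segment
      embedding_P[OF translate_inner(1)[OF n]]] by metis
  then show "compact (P n)" using compact_continuous_image compact_Icc by metis
next
  fix t assume "t \<in> D" "t \<notin> P 0"
  then obtain e where e: "e > 0"
      "\<And>g Y. g \<in> carrier G \<Longrightarrow> Y \<subseteq> D \<Longrightarrow> \<phi> g ` f ` {a..b} = f ` Y \<Longrightarrow> \<exists>s\<in>Y. e \<le> \<bar>s - t\<bar>"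
    using translates_separated[of t] P_zero by auto
  have "\<exists>s\<in>P n. e \<le> \<bar>s - t\<bar>" if n: "n - 1 \<in> I" "n + 1 \<in> I" for n
    using translate_inner[OF n] e(2) P_sub by blast
  then show "\<exists>e>0. \<forall>n. n - 1 \<in> I \<longrightarrow> n + 1 \<in> I \<longrightarrow> (\<exists>s\<in>P n. e \<le> \<bar>s - t\<bar>)"
    using e(1) by blast
qed (fact interval_D one_in neg_one_in interval_P P_sub nondegenerate interval_outer adjacent apart
    P_zero | erule (3) convex_I)+

section \<open>Indices and classes of the pieces\<close>

lemma index_unique:
  assumes "p \<in> I" "q \<in> I" "x \<in> P p \<inter> P q" "y \<in> P p \<inter> P q" "x \<noteq> y"
  shows "p = q"
proof (rule ccontr)
  assume "p \<noteq> q"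
  then consider "\<bar>p - q\<bar> = 1" | "\<bar>p - q\<bar> \<ge> 2" by linarith
  then show False
    using adjacent[OF assms(1,2)] apart[OF assms(1,2)] assms(3-5) by cases (metis singletonD, blast)
qed

lemma index_eq_if_sub:
  assumes "p \<in> I" "q \<in> I" "P p \<subseteq> P q"
  shows "p = q"
proof -
  obtain x y where "x \<in> P p" "y \<in> P p" "x < y" using nondegenerate[OF assms(1)] by blast
  then show ?thesis using index_unique[OF assms(1,2), of x y] assms(3) by auto
qed

lemma class_unique_inner:
  assumes p: "p - 1 \<in> I" "p + 1 \<in> I" and q: "q \<in> I" and eq: "c p = c q"
  shows "p = q"
proof -
  obtain g where g: "g \<in> carrier G" "c p = g <# K" "\<phi> g ` f ` {a..b} = f ` P p"
    using translate_inner[OF p] by blast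
  obtain h Q where h: "h \<in> carrier G" "Q \<subseteq> {a..b}" "c q = h <# K" "\<phi> h ` f ` Q = f ` P q"
    using translate[OF q] by blast
  have "\<phi> h ` f ` Q = \<phi> g ` f ` Q"
    unfolding image_image using coset_eqD[OF h(1) g(1)] eq g(2) h(2,3) segment_sub
    by (intro image_cong refl) auto
  moreover have "\<phi> g ` f ` Q \<subseteq> \<phi> g ` f ` {a..b}" using h(2) by (intro image_mono)
  ultimately have "f ` P q \<subseteq> f ` P p" using g(3) h(4) by simp
  then have "P q \<subseteq> P p"
    using inj_f P_sub[OF q] P_sub[OF translate_inner(1)[OF p]] by (simp add: inj_on_image_subset_iff)
  then show ?thesis
    using index_eq_if_sub[OF q translate_inner(1)[OF p]] by simp
qed

text \<open>A small ball inside both \<open>B\<close> and \<open>P m\<close> is pulled back to open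
  intervals in \<open>{a..b}\<close>, once by \<open>g\<close> and once by a representative of
  \<open>c m\<close>; freeness then identifies the classes.\<close>

lemma class_of_meeting:
  assumes g: "g \<in> carrier G" and A: "A \<subseteq> {a..b}" and B: "B \<subseteq> D" "openin (top_of_set D) B"
    and emb: "embedding_map (top_of_set B) M f" and eq: "\<phi> g ` f ` A = f ` B"
    and m: "m \<in> I" "B \<inter> interior (P m) \<noteq> {}"
  shows "g <# K = c m"
proof -
  obtain t where t: "t \<in> B" "t \<in> interior (P m)" using m by blast
  obtain U where U: "open U" "B = D \<inter> U" using B(2) by (auto simp: openin_open)
  have "open (U \<inter> interior (P m))" using U by auto
  then obtain e where e: "e > 0" "ball t e \<subseteq> U \<inter> interior (P m)"
    using t U open_contains_ball by blast
  \<comment> \<open>\<open>B\<close> is open only relative to \<open>D\<close>, but the ball lies in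
    \<open>P m\<close> and hence in \<open>D\<close>.\<close>
  have sub: "ball t e \<subseteq> B" "ball t e \<subseteq> P m"
    using e U P_sub[OF m(1)] interior_subset by blast+
  have C: "open (ball t e)" "connected (ball t e)" "ball t e \<noteq> {}"
    using e by (simp_all add: convex_connected)
  obtain A1 where A1: "A1 \<subseteq> A" "open A1" "connected A1" "A1 \<noteq> {}" "\<phi> g ` f ` A1 = f ` ball t e"
    using pull_back_open[OF g _ B(1) embedding_map_subset[OF embedding_segment A] emb eq sub(1) C]
      order_trans[OF A segment_sub] by metis
  obtain h Q where h: "h \<in> carrier G" "Q \<subseteq> {a..b}" "c m = h <# K" "\<phi> h ` f ` Q = f ` P m"
    using translate[OF m(1)] by blast
  obtain A2 where A2: "A2 \<subseteq> Q" "open A2" "connected A2" "A2 \<noteq> {}" "\<phi> h ` f ` A2 = f ` ball t e"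
    using pull_back_open[OF h(1) _ P_sub[OF m(1)] embedding_map_subset[OF embedding_segment h(2)]
        embedding_P[OF m(1)] h(4) sub(2) C] order_trans[OF h(2) segment_sub] by metis
  show ?thesis
    unfolding h(3) using A1 A2 A h(2) by (intro same_coset[OF g h(1), of A1 "ball t e" A2]) auto
qed

text \<open>An extremal index is the least or the greatest element of \<open>I\<close>. As
  \<open>I\<close> contains \<open>-1\<close> and \<open>1\<close>, the former is negative and the
  latter positive.\<close>

lemma outer_index:
  assumes "p \<in> I" "q \<in> I" "p \<noteq> q" "p - 1 \<notin> I \<or> p + 1 \<notin> I" "q - 1 \<notin> I \<or> q + 1 \<notin> I"
  shows "p < 0 \<and> 0 < q \<or> q < 0 \<and> 0 < p"
proof -
  have up: "n < 0" if "n - 1 \<notin> I" "n \<in> I" for n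
    using that convex_I[OF neg_one_in that(2), of "n - 1"] by linarith
  have down: "0 < n" if "n + 1 \<notin> I" "n \<in> I" for n
    using that convex_I[OF that(2) one_in, of "n + 1"] by linarith
  have "\<not> (n - 1 \<notin> I \<and> n < m \<and> m - 1 \<notin> I)" if "n \<in> I" "m \<in> I" for n m
    using convex_I[OF that, of "m - 1"] by auto
  moreover have "\<not> (n + 1 \<notin> I \<and> n < m)" if "n \<in> I" "m \<in> I" for n m
    using convex_I[OF that, of "n + 1"] by auto
  ultimately show ?thesis
    using assms up[of p] up[of q] down[of p] down[of q] by (metis linorder_neqE)
qed

text \<open>Openness of \<open>B\<close> is relative to \<open>D\<close> because an open segment of
  the curve may contain a boundary point of it.\<close>

theorem translate_in_unique_piece:
  assumes g: "g \<in> carrier G" and A: "A \<subseteq> {a..b}" and B: "B \<subseteq> D" "openin (top_of_set D) B"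
    and emb: "embedding_map (top_of_set B) M f" and eq: "\<phi> g ` f ` A = f ` B"
    and conn: "connected B" and ne: "B \<noteq> {}"
  shows "\<exists>n\<in>I. g <# K = c n \<and> B \<subseteq> P n"
proof -
  note meets = class_of_meeting[OF g A B emb eq]
  obtain t where "t \<in> B" using ne by blast
  then obtain m where m: "m \<in> I" "t \<in> P m" using cover B(1) by blast
  then have cm: "g <# K = c m"
    using meets interior_nonempty[OF m B(2) \<open>t \<in> B\<close>] by blast
  have "B \<subseteq> P m"
  proof
    fix s assume s: "s \<in> B"
    then obtain q where q: "q \<in> I" "s \<in> P q" using cover B(1) by blast
    then have cq: "g <# K = c q"
      using meets interior_nonempty[OF q B(2) s] by blast
    have "q = m"
    proof (rule ccontr)
      assume "q \<noteq> m"
      \<comment> \<open>Distinct indices of equal class are both extremal, hence on opposite sides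
        of \<open>0\<close>, and the interval \<open>B\<close> then has to contain
        \<open>P 0\<close>.\<close>
      then have "p - 1 \<notin> I \<or> p + 1 \<notin> I" if "p \<in> {q, m}" for p
        using class_unique_inner[of p] that q m cm cq by (metis empty_iff insert_iff)
      then consider "q < 0" "0 < m" | "m < 0" "0 < q"
        using outer_index[OF q(1) m(1) \<open>q \<noteq> m\<close>] by auto
      then have "P 0 \<subseteq> B"
        using between q m s \<open>t \<in> B\<close> conn by (metis is_interval_connected_1)
      \<comment> \<open>Meeting \<open>P 0\<close> gives the index \<open>0\<close> the class of
        \<open>g\<close> as well. But \<open>0\<close> is inner and shares its class with no other
        index.\<close>
      then obtain r where r: "r \<in> P 0" "r \<in> B" using P_zero a_less_b by fastforce
      have "c 0 = c m" using meets[OF zero_in interior_nonempty[OF zero_in r(1) B(2) r(2)]] cm by simp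
      moreover have "c 0 = c q" using \<open>c 0 = c m\<close> cm cq by simp
      ultimately have "0 = m" "0 = q"
        using class_unique_inner[of 0] one_in neg_one_in m q by auto
      then show False using \<open>q \<noteq> m\<close> by simp
    qed
    then show "s \<in> P m" using q by simp
  qed
  then show ?thesis using m cm by blast
qed

lemma interior_P: "n \<in> I \<Longrightarrow> interior (P n) \<noteq> {}" "n \<in> I \<Longrightarrow> connected (interior (P n))"
proof -
  assume n: "n \<in> I"
  then obtain t where "t \<in> P n" using nondegenerate by blast
  then have "D \<inter> interior (P n) \<noteq> {}"
    using interior_nonempty[OF n, of t D] P_sub[OF n] by auto
  then show "interior (P n) \<noteq> {}" by blast
  show "connected (interior (P n))"
    using interval_P[OF n] by (simp add: convex_connected convex_interior is_interval_convex_1)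
qed

text \<open>An interval with nonempty interior lies in the closure of that interior, and the pieces
  are closed in \<open>D\<close>. This restores the endpoints after an argument about open
  sets.\<close>

lemma sub_if_interior_sub:
  assumes n: "n \<in> I" and X: "is_interval X" "interior X \<noteq> {}" "X \<subseteq> D" "interior X \<subseteq> P n"
  shows "X \<subseteq> P n"
proof -
  obtain C where C: "closed C" "P n = D \<inter> C" using closedin_P[OF n] by (auto simp: closedin_closed)
  have "X \<subseteq> closure (interior X)"
    using X(1,2) convex_closure_interior[of X] closure_subset by (auto simp: is_interval_convex_1)
  also have "\<dots> \<subseteq> C" using C X(4) by (intro closure_minimal) auto
  finally show ?thesis using C X(3) by auto
qed

end

lemma refinement:
  assumes "free_curve_decomposition G M \<phi> f D a b K P I c"
    and "free_curve_decomposition G M \<phi> f D a b K P' I' c'"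
    and m: "m \<in> I'"
  shows "\<exists>n\<in>I. c' m = c n \<and> P' m \<subseteq> P n"
proof -
  interpret p: free_curve_decomposition G M \<phi> f D a b K P I c by fact
  interpret p': free_curve_decomposition G M \<phi> f D a b K P' I' c' by fact
  obtain g Q where g: "g \<in> carrier G" "Q \<subseteq> {a..b}" "c' m = g <#\<^bsub>G\<^esub> K" "\<phi> g ` f ` Q = f ` P' m"
    using p'.translate[OF m] by blast
  \<comment> \<open>The containment theorem asks for a relatively open set, so it is applied to the
    interior of the piece.\<close>
  let ?B = "interior (P' m)"
  note B = interior_subset[of "P' m"] open_interior[of "P' m"] p'.interior_P(2,1)[OF m]
  have "embedding_map (top_of_set Q) M f" using embedding_map_subset[OF p.embedding_segment g(2)] .
  then obtain A where A: "A \<subseteq> Q" "\<phi> g ` f ` A = f ` ?B"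
    using p.pull_back_open[OF g(1) _ p'.P_sub[OF m] _ p'.embedding_P[OF m] g(4) B]
      order_trans[OF g(2) p.segment_sub] by metis
  have BD: "?B \<subseteq> D" using B(1) p'.P_sub[OF m] by blast
  obtain n where n: "n \<in> I" "g <#\<^bsub>G\<^esub> K = c n" "?B \<subseteq> P n"
    using p.translate_in_unique_piece[OF g(1) _ BD _ embedding_map_subset[OF p'.embedding_P[OF m] B(1)]
        A(2) B(3,4)] A(1) g(2) BD open_subset[OF BD B(2)] by blast
  then show ?thesis
    using p.sub_if_interior_sub[OF n(1) p'.interval_P[OF m] B(4) p'.P_sub[OF m] n(3)] g(3) by auto
qed

lemma decomposition_unique:
  assumes dec: "free_curve_decomposition G M \<phi> f D a b K P I c"
    and dec': "free_curve_decomposition G M \<phi> f D a b K P' I' c'"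
  shows "I' = I \<and> (\<forall>n\<in>I. P' n = P n \<and> c' n = c n) \<or>
    I' = uminus ` I \<and> (\<forall>n\<in>uminus ` I. P' n = P (- n) \<and> c' n = c (- n))"
proof -
  interpret p: free_curve_decomposition G M \<phi> f D a b K P I c by fact
  interpret p': free_curve_decomposition G M \<phi> f D a b K P' I' c' by fact
  obtain \<sigma> where \<sigma>: "\<And>m. m \<in> I' \<Longrightarrow> \<sigma> m \<in> I \<and> c' m = c (\<sigma> m) \<and> P' m \<subseteq> P (\<sigma> m)"
    using refinement[OF dec dec'] by metis
  obtain \<tau> where \<tau>: "\<And>n. n \<in> I \<Longrightarrow> \<tau> n \<in> I' \<and> P n \<subseteq> P' (\<tau> n)"
    using refinement[OF dec' dec] by metis
  \<comment> \<open>Here \<open>P' m \<subseteq> P (\<sigma> m) \<subseteq> P' (\<tau> (\<sigma>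
    m))\<close>, and no piece of a decomposition is contained in another one.\<close>
  have \<tau>\<sigma>: "\<tau> (\<sigma> m) = m" if m: "m \<in> I'" for m
  proof -
    have "P' m \<subseteq> P' (\<tau> (\<sigma> m))" using \<sigma>[OF m] \<tau>[of "\<sigma> m"] by blast
    then show ?thesis
      using p'.index_eq_if_sub[OF m, of "\<tau> (\<sigma> m)"] \<sigma>[OF m] \<tau> by simp
  qed
  have \<sigma>\<tau>: "\<sigma> (\<tau> n) = n" if n: "n \<in> I" for n
  proof -
    have "P n \<subseteq> P (\<sigma> (\<tau> n))" using \<tau>[OF n] \<sigma>[of "\<tau> n"] by blast
    then show ?thesis
      using p.index_eq_if_sub[OF n, of "\<sigma> (\<tau> n)"] \<sigma> \<tau>[OF n] by simp
  qed
  have P: "P' m = P (\<sigma> m)" if "m \<in> I'" for m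
    using \<sigma>[OF that] \<tau>[of "\<sigma> m"] \<tau>\<sigma>[OF that] by auto
  have bij: "bij_betw \<sigma> I' I"
    using \<sigma> \<tau> \<tau>\<sigma> \<sigma>\<tau> by (intro bij_betwI[where g = \<tau>]) auto
  \<comment> \<open>Adjacency can be read off the sets alone: distinct pieces meet only if their
    indices are neighbours.\<close>
  have adj: "\<bar>\<sigma> i - \<sigma> j\<bar> = 1" if ij: "i \<in> I'" "j \<in> I'" "\<bar>i - j\<bar> = 1" for i j
  proof -
    have "P (\<sigma> i) \<inter> P (\<sigma> j) \<noteq> {}" using p'.adjacent[OF ij] P[OF ij(1)] P[OF ij(2)] by force
    then have "\<not> \<bar>\<sigma> i - \<sigma> j\<bar> \<ge> 2" using p.apart[of "\<sigma> i" "\<sigma> j"] \<sigma> ij(1,2) by blast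
    moreover have "\<sigma> i \<noteq> \<sigma> j" 
    proof
      assume "\<sigma> i = \<sigma> j"
      then have "\<tau> (\<sigma> i) = \<tau> (\<sigma> j)" by simp
      then show False using ij(3) unfolding \<tau>\<sigma>[OF ij(1)] \<tau>\<sigma>[OF ij(2)] by simp
    qed
    ultimately show ?thesis by linarith
  qed
  \<comment> \<open>Both decompositions start from the same segment \<open>{a..b}\<close>, which
    pins down the index \<open>0\<close>.\<close>
  have "P (\<sigma> 0) = P 0" using P[OF p'.zero_in] p.P_zero p'.P_zero by simp
  then have "\<sigma> 0 = 0"
    using p.index_eq_if_sub[of "\<sigma> 0" 0] \<sigma>[OF p'.zero_in] p.zero_in by blast
  have "(\<forall>m\<in>I'. \<sigma> m = m) \<or> (\<forall>m\<in>I'. \<sigma> m = - m)"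
    by (rule path_automorphism[OF bij_betw_imp_inj_on[OF bij] p'.one_in p'.neg_one_in _ _ \<open>\<sigma> 0 = 0\<close>])
       (fact adj | erule (3) p'.convex_I)+
  then consider "\<forall>m\<in>I'. \<sigma> m = m" | "\<forall>m\<in>I'. \<sigma> m = - m" by blast
  then show ?thesis
  proof cases
    case 1
    then have "\<sigma> ` I' = I'" by simp
    then have "I' = I" using bij_betw_imp_surj_on[OF bij] by simp
    then show ?thesis using 1 \<sigma> P by auto
  next
    case 2
    then have "\<sigma> ` I' = uminus ` I'" by simp
    then have "I = uminus ` I'" using bij_betw_imp_surj_on[OF bij] by simp
    then have "I' = uminus ` I" by (simp add: image_image)
    then show ?thesis using 2 \<sigma> P by auto
  qed
qed

section \<open>Pulling back to the parameter interval\<close>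

lemma index_set_cases:
  fixes lo hi :: "int extended"
  assumes "lo < 0" "0 < hi"
  shows "1 \<in> index_set lo hi" "-1 \<in> index_set lo hi"
    and "n - 1 \<in> index_set lo hi \<and> n + 1 \<in> index_set lo hi \<longleftrightarrow> lo < Fin n \<and> Fin n < hi"
    and "n \<in> index_set lo hi \<longleftrightarrow> lo < Fin n \<and> Fin n < hi \<or> Fin n = lo \<or> Fin n = hi"
proof -
  show "1 \<in> index_set lo hi" "-1 \<in> index_set lo hi"
    using assms unfolding index_set_def zero_extended_def by (cases lo; cases hi; simp)+
  show "n - 1 \<in> index_set lo hi \<and> n + 1 \<in> index_set lo hi \<longleftrightarrow> lo < Fin n \<and> Fin n < hi"
    using assms unfolding index_set_def zero_extended_def by (cases lo; cases hi) auto
  show "n \<in> index_set lo hi \<longleftrightarrow> lo < Fin n \<and> Fin n < hi \<or> Fin n = lo \<or> Fin n = hi"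
    using assms unfolding index_set_def zero_extended_def by (cases lo; cases hi) auto
qed

lemma index_set_uminus: "index_set (- hi) (- lo) = uminus ` index_set lo hi"
proof -
  have iff: "n \<in> index_set (- hi) (- lo) \<longleftrightarrow> - n \<in> index_set lo hi" for n
    by (cases lo; cases hi; simp add: index_set_def; linarith)
  show ?thesis
  proof
    show "index_set (- hi) (- lo) \<subseteq> uminus ` index_set lo hi"
    proof
      fix n assume "n \<in> index_set (- hi) (- lo)"
      then show "n \<in> uminus ` index_set lo hi" using iff by (intro image_eqI[of _ _ "- n"]) simp_all
    qed
    show "uminus ` index_set lo hi \<subseteq> index_set (- hi) (- lo)" using iff by (simp add: image_subset_iff)
  qed
qed

text \<open>The signs of the bounds put \<open>0\<close> into both index sets; empty index sets
  would not determine their bounds. Different bounds on one side are then told apart by a finite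
  bound or by the integer just beyond it.\<close>

lemma index_set_inject:
  assumes "lo < 0" "0 < hi" "lo' < 0" "0 < hi'" and eq: "index_set lo' hi' = index_set lo hi"
  shows "lo' = lo" "hi' = hi"
proof -
  have mem: "lo' \<le> Fin n \<and> Fin n \<le> hi' \<longleftrightarrow> lo \<le> Fin n \<and> Fin n \<le> hi" for n
    using eq unfolding index_set_def by blast
  show "lo' = lo"
  proof (cases lo; cases lo')
    fix x y assume "lo = Fin x" "lo' = Fin y"
    then show ?thesis
      using mem[of x] mem[of y] assms(1-4) by (cases hi; cases hi'; auto simp: zero_extended_def)
  next
    fix x assume "lo = Fin x" "lo' = Minf"
    then show ?thesis
      using mem[of "x - 1"] assms(1-4) by (cases hi; cases hi'; auto simp: zero_extended_def)
  next
    fix x assume "lo = Minf" "lo' = Fin x"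
    then show ?thesis
      using mem[of "x - 1"] assms(1-4) by (cases hi; cases hi'; auto simp: zero_extended_def)
  qed (use assms in \<open>auto simp: zero_extended_def\<close>)
  show "hi' = hi"
  proof (cases hi; cases hi')
    fix x y assume "hi = Fin x" "hi' = Fin y"
    then show ?thesis
      using mem[of x] mem[of y] assms(1-4) by (cases lo; cases lo'; auto simp: zero_extended_def)
  next
    fix x assume "hi = Fin x" "hi' = Pinf"
    then show ?thesis
      using mem[of "x + 1"] assms(1-4) by (cases lo; cases lo'; auto simp: zero_extended_def)
  next
    fix x assume "hi = Pinf" "hi' = Fin x"
    then show ?thesis
      using mem[of "x + 1"] assms(1-4) by (cases lo; cases lo'; auto simp: zero_extended_def)
  qed (use assms in \<open>auto simp: zero_extended_def\<close>)
qed

lemma segment_decompositionD: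
  assumes "segment_decomposition G M \<phi> S \<iota> D \<upsilon> \<Sigma> lo hi Sg c"
  shows "lo < 0" "0 < hi" "Sg 0 = \<Sigma>"
    and "n \<in> index_set lo hi \<Longrightarrow> c n \<in> lcosets\<^bsub>G\<^esub> (curve_stabilizer G \<phi> S \<iota>)"
    and "n \<in> index_set lo hi \<Longrightarrow> segment S (Sg n)"
    and "n \<in> index_set lo hi \<Longrightarrow> embedded_on M S \<iota> (Sg n)"
    and "Fin n = lo \<or> Fin n = hi \<Longrightarrow> boundary_segment S (topspace S) (Sg n)"
    and "p \<in> index_set lo hi \<Longrightarrow> q \<in> index_set lo hi \<Longrightarrow> \<bar>p - q\<bar> = 1 \<Longrightarrow>
      Sg p \<inter> Sg q = seg_bd D \<upsilon> (Sg p) \<inter> seg_bd D \<upsilon> (Sg q) \<and> is_singleton (Sg p \<inter> Sg q)"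
    and "p \<in> index_set lo hi \<Longrightarrow> q \<in> index_set lo hi \<Longrightarrow> \<bar>p - q\<bar> \<ge> 2 \<Longrightarrow> Sg p \<inter> Sg q = {}"
    and "lo < Fin n \<and> Fin n < hi \<Longrightarrow>
      \<exists>g\<in>carrier G. c n = curve_class G \<phi> S \<iota> g \<and> \<phi> g ` \<iota> ` Sg 0 = \<iota> ` Sg n"
    and "Fin n = lo \<or> Fin n = hi \<Longrightarrow> \<exists>g\<in>carrier G. c n = curve_class G \<phi> S \<iota> g \<and>
      (\<exists>B. boundary_segment S (Sg 0) B \<and> \<phi> g ` \<iota> ` B = \<iota> ` Sg n)"
proof -
  note dec = assms[unfolded segment_decomposition_def]
  show "lo < 0" using dec by (rule conjunct1)
  show "0 < hi" using dec by (elim conjE)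
  show "Sg 0 = \<Sigma>" using dec by (elim conjE)
  have "\<forall>n\<in>index_set lo hi. c n \<in> lcosets\<^bsub>G\<^esub> (curve_stabilizer G \<phi> S \<iota>) \<and>
      segment S (Sg n) \<and> embedded_on M S \<iota> (Sg n)"
    using dec by (elim conjE)
  then show "n \<in> index_set lo hi \<Longrightarrow> c n \<in> lcosets\<^bsub>G\<^esub> (curve_stabilizer G \<phi> S \<iota>)"
    "n \<in> index_set lo hi \<Longrightarrow> segment S (Sg n)"
    "n \<in> index_set lo hi \<Longrightarrow> embedded_on M S \<iota> (Sg n)" by simp_all
  have "\<forall>n. Fin n = lo \<or> Fin n = hi \<longrightarrow> boundary_segment S (topspace S) (Sg n)"
    using dec by (elim conjE)
  then show "Fin n = lo \<or> Fin n = hi \<Longrightarrow> boundary_segment S (topspace S) (Sg n)" by blast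
  have *: "\<forall>p\<in>index_set lo hi. \<forall>q\<in>index_set lo hi.
      (\<bar>p - q\<bar> = 1 \<longrightarrow>
        Sg p \<inter> Sg q = seg_bd D \<upsilon> (Sg p) \<inter> seg_bd D \<upsilon> (Sg q) \<and> is_singleton (Sg p \<inter> Sg q)) \<and>
      (\<bar>p - q\<bar> \<ge> 2 \<longrightarrow> Sg p \<inter> Sg q = {})"
    using dec by (elim conjE)
  show "p \<in> index_set lo hi \<Longrightarrow> q \<in> index_set lo hi \<Longrightarrow> \<bar>p - q\<bar> = 1 \<Longrightarrow>
      Sg p \<inter> Sg q = seg_bd D \<upsilon> (Sg p) \<inter> seg_bd D \<upsilon> (Sg q) \<and> is_singleton (Sg p \<inter> Sg q)"
    using bspec[OF bspec[OF *]] by blast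
  show "p \<in> index_set lo hi \<Longrightarrow> q \<in> index_set lo hi \<Longrightarrow> \<bar>p - q\<bar> \<ge> 2 \<Longrightarrow> Sg p \<inter> Sg q = {}"
    using bspec[OF bspec[OF *]] by blast
  have "\<forall>n. lo < Fin n \<and> Fin n < hi \<longrightarrow>
      (\<exists>g\<in>carrier G. c n = curve_class G \<phi> S \<iota> g \<and> \<phi> g ` \<iota> ` Sg 0 = \<iota> ` Sg n)"
    using dec by (elim conjE)
  then show "lo < Fin n \<and> Fin n < hi \<Longrightarrow>
      \<exists>g\<in>carrier G. c n = curve_class G \<phi> S \<iota> g \<and> \<phi> g ` \<iota> ` Sg 0 = \<iota> ` Sg n"
    by (rule allE) (erule (1) mp)
  have "\<forall>n. Fin n = lo \<or> Fin n = hi \<longrightarrow> (\<exists>g\<in>carrier G. c n = curve_class G \<phi> S \<iota> g \<and>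
      (\<exists>B. boundary_segment S (Sg 0) B \<and> \<phi> g ` \<iota> ` B = \<iota> ` Sg n))"
    using dec by (elim conjE)
  then show "Fin n = lo \<or> Fin n = hi \<Longrightarrow> \<exists>g\<in>carrier G. c n = curve_class G \<phi> S \<iota> g \<and>
      (\<exists>B. boundary_segment S (Sg 0) B \<and> \<phi> g ` \<iota> ` B = \<iota> ` Sg n)"
    by (rule allE) (erule (1) mp)
qed

text \<open>Negation keeps inner indices inner and exchanges the two ends, so each clause at
  \<open>n\<close> is the original clause at \<open>- n\<close>.\<close>

lemma segment_decomposition_reverse:
  assumes "segment_decomposition G M \<phi> S \<iota> D \<upsilon> \<Sigma> lo hi Sg c"
  shows "segment_decomposition G M \<phi> S \<iota> D \<upsilon> \<Sigma> (- hi) (- lo) (\<lambda>n. Sg (- n)) (\<lambda>n. c (- n))"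
proof -
  note dec = segment_decompositionD[OF assms]
  have ends: "- hi < 0 \<longleftrightarrow> 0 < hi" "0 < - lo \<longleftrightarrow> lo < 0"
    by (cases hi; cases lo; auto simp: zero_extended_def)+
  have mem: "n \<in> index_set (- hi) (- lo) \<longleftrightarrow> - n \<in> index_set lo hi" for n
    by (cases lo; cases hi; auto simp: index_set_def)
  have inner: "- hi < Fin n \<and> Fin n < - lo \<longleftrightarrow> lo < Fin (- n) \<and> Fin (- n) < hi" for n
    by (cases lo; cases hi; auto)
  have outer: "Fin n = - hi \<or> Fin n = - lo \<longleftrightarrow> Fin (- n) = lo \<or> Fin (- n) = hi" for n
    by (cases lo; cases hi; auto)
  have diff: "\<bar>- p - - q\<bar> = \<bar>p - q\<bar>" for p q :: int by simp
  show ?thesis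
    unfolding segment_decomposition_def ends inner outer minus_zero
  proof (intro conjI ballI allI impI)
    fix p q assume pq: "p \<in> index_set (- hi) (- lo)" "q \<in> index_set (- hi) (- lo)"
    note pq = pq[unfolded mem]
    show "Sg (- p) \<inter> Sg (- q) = {}" if "\<bar>p - q\<bar> \<ge> 2"
      using dec(9)[OF pq] that unfolding diff .
    show "Sg (- p) \<inter> Sg (- q) = seg_bd D \<upsilon> (Sg (- p)) \<inter> seg_bd D \<upsilon> (Sg (- q))"
      "is_singleton (Sg (- p) \<inter> Sg (- q))" if "\<bar>p - q\<bar> = 1"
      using dec(8)[OF pq] that unfolding diff by blast+
  qed (fact dec(1-3) | (rule dec, simp only: mem; fail) | erule dec)+
qed

section \<open>Curves read on a parameter interval\<close>

locale parametrized_curve =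
  fixes M :: "'m topology" and S :: "'s topology" and \<iota> :: "'s \<Rightarrow> 'm" and D and \<upsilon> :: "real \<Rightarrow> 's"
  assumes parametrization: "interval_parametrization D S \<upsilon>"
    and continuous_curve: "continuous_map S M \<iota>"
    and inj_curve: "inj_on \<iota> (topspace S)"
begin

text \<open>This is the set whose interior in the real line defines \<open>seg_int\<close>, so a
  point of \<open>seg_bd\<close> becomes a parameter outside
  \<open>interior (preimage A)\<close>.\<close>

definition preimage :: "'s set \<Rightarrow> real set" where
  "preimage A = {t \<in> D. \<upsilon> t \<in> A}"

abbreviation curve :: "real \<Rightarrow> 'm" where
  "curve \<equiv> \<lambda>t. \<iota> (\<upsilon> t)"

lemma hom: "homeomorphic_map (top_of_set D) S \<upsilon>" and interval_D: "is_interval D"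
  using parametrization by (auto simp: interval_parametrization_def)

lemma \<upsilon>_image: "\<upsilon> ` D = topspace S" and inj_\<upsilon>: "inj_on \<upsilon> D"
  using homeomorphic_imp_surjective_map[OF hom] homeomorphic_imp_injective_map[OF hom] by auto

lemma preimage_sub: "preimage A \<subseteq> D"
  by (auto simp: preimage_def)

lemma image_preimage: "A \<subseteq> topspace S \<Longrightarrow> \<upsilon> ` preimage A = A"
  using \<upsilon>_image by (auto simp: preimage_def)

lemma curve_preimage: "A \<subseteq> topspace S \<Longrightarrow> curve ` preimage A = \<iota> ` A"
  using image_preimage[of A] by (metis image_image)

lemma preimage_inject:
  "A \<subseteq> topspace S \<Longrightarrow> B \<subseteq> topspace S \<Longrightarrow> preimage A = preimage B \<Longrightarrow> A = B"
  using image_preimage by metis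

lemma connected_iff: "X \<subseteq> D \<Longrightarrow> connectedin S (\<upsilon> ` X) \<longleftrightarrow> connected X"
  using homeomorphic_map_connectedness[OF hom, of X] by (simp add: connectedin_subtopology)

lemma openin_iff: "X \<subseteq> D \<Longrightarrow> openin S (\<upsilon> ` X) \<longleftrightarrow> openin (top_of_set D) X"
  using homeomorphic_map_openness[OF hom, of X] by simp

lemma connected_preimage: "connectedin S A \<Longrightarrow> connected (preimage A)"
  using connected_iff[OF preimage_sub, of A] image_preimage[of A] by (simp add: connectedin_subset_topspace)

lemma compact_preimage: "compactin S A \<Longrightarrow> compact (preimage A)"
  using homeomorphic_map_compactness[OF hom, of "preimage A"] image_preimage[of A] preimage_sub[of A]
  by (simp add: compactin_subset_topspace compactin_subtopology)

lemma segment_preimage: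
  assumes "segment S A"
  shows "A \<subseteq> topspace S" "is_interval (preimage A)" "\<exists>x\<in>preimage A. \<exists>y\<in>preimage A. x < y"
proof -
  have "connectedin S A" using assms by (simp add: segment_def)
  then show sub: "A \<subseteq> topspace S" and "is_interval (preimage A)"
    using connected_preimage by (auto simp: connectedin_subset_topspace is_interval_connected_1)
  obtain p q where "p \<in> A" "q \<in> A" "p \<noteq> q" using assms by (auto simp: segment_def)
  then obtain x y where "x \<in> preimage A" "y \<in> preimage A" "\<upsilon> x = p" "\<upsilon> y = q"
    using image_preimage[OF sub] by (metis imageE)
  then show "\<exists>x\<in>preimage A. \<exists>y\<in>preimage A. x < y"
    using \<open>p \<noteq> q\<close> by (metis linorder_neqE_linordered_idom)
qed

lemma embedding_preimage:
  assumes "embedded_on M S \<iota> A" and "A \<subseteq> topspace S"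
  shows "embedding_map (top_of_set (preimage A)) M curve"
proof -
  have "homeomorphic_map (subtopology (top_of_set D) (preimage A)) (subtopology S A) \<upsilon>"
    using image_preimage[OF assms(2)] preimage_sub[of A] assms(2)
    by (intro homeomorphic_map_subtopologies[OF hom]) (simp add: Int_absorb1)
  moreover have "subtopology (top_of_set D) (preimage A) = top_of_set (preimage A)"
    using preimage_sub[of A] by (simp add: subtopology_subtopology Int_absorb1)
  ultimately have "embedding_map (top_of_set (preimage A)) (subtopology S A) \<upsilon>"
    by (metis surjective_embedding_map)
  from embedding_map_compose[OF this] show ?thesis
    using assms(1) by (simp add: embedded_on_def o_def)
qed

lemma open_segment_image:
  assumes "X \<subseteq> D" "open X" "connected X" "X \<noteq> {}"
  shows "open_segment_in S (\<upsilon> ` X)"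
proof -
  obtain x where "x \<in> X" using assms(4) by blast
  then obtain e where "e > 0" "ball x e \<subseteq> X" using assms(2) open_contains_ball by blast
  \<comment> \<open>A second point next to \<open>x\<close> shows that the image is
    nondegenerate.\<close>
  then have "x + e / 2 \<in> X" by (auto simp: subset_iff dist_real_def)
  then have "\<upsilon> x \<noteq> \<upsilon> (x + e / 2)"
    using inj_\<upsilon> assms(1) \<open>x \<in> X\<close> \<open>e > 0\<close> by (auto dest!: inj_onD)
  then have "\<exists>p\<in>\<upsilon> ` X. \<exists>q\<in>\<upsilon> ` X. p \<noteq> q" using \<open>x \<in> X\<close> \<open>x + e / 2 \<in> X\<close> by blast
  then show ?thesis
    using assms connected_iff[OF assms(1)] openin_iff[OF assms(1)] open_subset[OF assms(1,2)]
    by (simp add: open_segment_in_def segment_def)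
qed

lemma notin_seg_bd:
  assumes "t \<in> D" "\<upsilon> t \<in> seg_bd D \<upsilon> A"
  shows "t \<notin> interior (preimage A)"
  using assms by (auto simp: seg_bd_def seg_int_def preimage_def)

end

lemma free_curve_preimage:
  assumes "parametrized_curve M S \<iota> D \<upsilon>"
    and action: "group_action G (topspace M) \<phi>"
    and nc: "non_contractive G d M \<A> \<phi>"
    and free: "\<Sigma> \<in> free_segments G M \<phi> S \<iota>"
    and emb: "embedded_on M S \<iota> \<Sigma>"
    and ab: "parametrized_curve.preimage D \<upsilon> \<Sigma> = {a..b}"
  shows "free_curve G M \<phi> (\<lambda>t. \<iota> (\<upsilon> t)) D a b (curve_stabilizer G \<phi> S \<iota>)"
proof -
  interpret parametrized_curve M S \<iota> D \<upsilon> by fact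
  interpret group_action G "topspace M" \<phi> by fact
  interpret group G using group_hom group_hom.axioms(1) by blast
  have seg: "segment S \<Sigma>" using free by (simp add: free_segments_def)
  note \<Sigma> = segment_preimage[OF seg]
  have curve_D: "curve ` D \<subseteq> topspace M"
    using continuous_map_image_subset_topspace[OF continuous_curve] \<upsilon>_image by (auto simp: image_subset_iff)
  have abD: "{a..b} \<subseteq> D" using preimage_sub[of \<Sigma>] ab by simp
  have inj: "inj_on curve D"
    using comp_inj_on[OF inj_\<upsilon>, of \<iota>] inj_curve by (simp add: \<upsilon>_image o_def)
  have cont: "continuous_map (top_of_set D) M curve"
    using continuous_map_compose[OF homeomorphic_imp_continuous_map[OF hom] continuous_curve]
    by (simp add: o_def)
  show ?thesis
  proof (intro free_curve.intro free_curve_axioms.intro action)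
    fix g assume "g \<in> carrier G"
    then show "continuous_map M M (\<phi> g)"
      using nc by (simp add: non_contractive_def analytic_map_def)
  next
    \<comment> \<open>An intersection of stabilizers over an empty curve would be the whole type
      instead of a subgroup, so nonemptiness comes first.\<close>
    have "\<upsilon> ` D \<noteq> {}" using \<Sigma>(3) preimage_sub[of \<Sigma>] by blast
    then have "topspace S \<noteq> {}" using \<upsilon>_image by simp
    moreover have "\<iota> z \<in> topspace M" if "z \<in> topspace S" for z
      using continuous_map_image_subset_topspace[OF continuous_curve] that by blast
    ultimately show "subgroup (curve_stabilizer G \<phi> S \<iota>) G"
      unfolding curve_stabilizer_def by (intro subgroups_Inter) (auto intro: stabilizer_subgroup)
  next
    fix g t assume "g \<in> curve_stabilizer G \<phi> S \<iota>" "t \<in> D"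
    then show "\<phi> g (curve t) = curve t"
      using \<upsilon>_image by (auto simp: curve_stabilizer_def stabilizer_def)
  next
    show "embedding_map (top_of_set {a..b}) M curve"
      using embedding_preimage[OF emb \<Sigma>(1)] ab by simp
  next
    fix g A B assume g: "g \<in> carrier G" and A: "A \<subseteq> {a..b}" "open A" "connected A" "A \<noteq> {}"
      and B: "B \<subseteq> {a..b}" "open B" "connected B" "B \<noteq> {}" and eq: "\<phi> g ` curve ` A = curve ` B"
    have sub: "\<upsilon> ` A \<subseteq> \<Sigma>" "\<upsilon> ` B \<subseteq> \<Sigma>" "A \<subseteq> D" "B \<subseteq> D"
      using A(1) B(1) ab abD by (auto simp: preimage_def)
    have "embedded_on M S \<iota> (\<upsilon> ` A)" "embedded_on M S \<iota> (\<upsilon> ` B)"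
      using embedding_map_subset sub(1,2) emb unfolding embedded_on_def by blast+
    moreover have "\<phi> g ` \<iota> ` \<upsilon> ` A = \<iota> ` \<upsilon> ` B" using eq by (simp add: image_image)
    ultimately have "overlaps M \<phi> S \<iota> g \<Sigma> \<Sigma>"
      unfolding overlaps_def
      using open_segment_image[OF sub(3) A(2-4)] open_segment_image[OF sub(4) B(2-4)] sub(1,2) by blast
    then show "g \<in> curve_stabilizer G \<phi> S \<iota>"
      using free g by (simp add: free_segments_def)
  next
    fix t assume t: "t \<in> D" "t \<notin> {a..b}"
    let ?C = "curve ` {a..b}"
    have C: "?C \<subseteq> topspace M" using curve_D abD by blast
    have "\<exists>p\<in>?C. \<exists>q\<in>?C. p \<noteq> q"
    proof -
      obtain x y where xy: "x \<in> {a..b}" "y \<in> {a..b}" "x < y" using \<Sigma>(3) ab by auto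
      moreover from this have "x \<in> D" "y \<in> D" using abD by blast+
      ultimately have "curve x \<noteq> curve y" using inj_onD[OF inj, of x y] by auto
      then show ?thesis using xy(1,2) by blast
    qed
    moreover have "curve t \<in> topspace M - ?C"
      using curve_D t inj_on_image_mem_iff[OF inj t(1) abD] by auto
    ultimately have "?C \<subseteq> topspace M \<and> (\<exists>p\<in>?C. \<exists>q\<in>?C. p \<noteq> q) \<and> curve t \<in> topspace M - ?C"
      using C by (intro conjI)
    \<comment> \<open>Non-contractivity is applied to the image of the segment and the point
      \<open>curve t\<close> off it: \<open>U\<close> contains no translate of the segment.\<close>
    from nc[unfolded non_contractive_def, THEN conjunct2, THEN spec, THEN spec, THEN mp, OF this]
    obtain U where U: "openin M U" "curve t \<in> U" "\<forall>g\<in>carrier G. \<not> \<phi> g ` ?C \<subseteq> U"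
      by (elim exE conjE)
    have "openin (top_of_set D) {s \<in> D. curve s \<in> U}"
      using openin_continuous_map_preimage[OF cont U(1)] by simp
    \<comment> \<open>By continuity \<open>U\<close> pulls back to a neighbourhood of
      \<open>t\<close> in \<open>D\<close>. A translate parametrized within distance
      \<open>e\<close> of \<open>t\<close> would lie in \<open>U\<close>.\<close>
    then obtain e where e: "e > 0" "ball t e \<inter> D \<subseteq> {s \<in> D. curve s \<in> U}"
      using t(1) U(2) by (metis (mono_tags, lifting) mem_Collect_eq openin_contains_ball)
    have "\<exists>s\<in>Y. e \<le> \<bar>s - t\<bar>" if "g \<in> carrier G" "Y \<subseteq> D" "\<phi> g ` ?C = curve ` Y" for g Y
    proof (rule ccontr)
      assume far: "\<not> ?thesis"
      have "s \<in> ball t e \<inter> D" if "s \<in> Y" for s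
        using far that \<open>Y \<subseteq> D\<close> by (auto simp: dist_real_def abs_minus_commute not_le)
      then have "curve ` Y \<subseteq> U" using e(2) by blast
      then show False using bspec[OF U(3) that(1)] that(3) by simp
    qed
    then show "\<exists>e>0. \<forall>g\<in>carrier G. \<forall>Y\<subseteq>D. \<phi> g ` ?C = curve ` Y \<longrightarrow> (\<exists>s\<in>Y. e \<le> \<bar>s - t\<bar>)"
      using e(1) by (intro exI[of _ e] conjI ballI allI impI)
  qed (fact interval_D inj curve_D abD)+
qed

lemma free_curve_decomposition_preimage:
  assumes "parametrized_curve M S \<iota> D \<upsilon>"
    and fc: "free_curve G M \<phi> (\<lambda>t. \<iota> (\<upsilon> t)) D a b (curve_stabilizer G \<phi> S \<iota>)"
    and ab: "parametrized_curve.preimage D \<upsilon> \<Sigma> = {a..b}"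
    and dec: "segment_decomposition G M \<phi> S \<iota> D \<upsilon> \<Sigma> lo hi Sg c"
  shows "free_curve_decomposition G M \<phi> (\<lambda>t. \<iota> (\<upsilon> t)) D a b (curve_stabilizer G \<phi> S \<iota>)
    (\<lambda>n. parametrized_curve.preimage D \<upsilon> (Sg n)) (index_set lo hi) c"
proof -
  interpret parametrized_curve M S \<iota> D \<upsilon> by fact
  interpret free_curve G M \<phi> curve D a b "curve_stabilizer G \<phi> S \<iota>" by fact
  let ?I = "index_set lo hi"
  note dec = segment_decompositionD[OF dec]
  note lo = dec(1) and hi = dec(2) and Sg0 = dec(3) and seg = dec(5) and emb = dec(6)
  note index = index_set_cases[OF lo hi]
  note pre = segment_preimage[OF seg]
  \<comment> \<open>Extremality in the sense of a missing neighbour is traced back to the finite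
    ends \<open>lo\<close> and \<open>hi\<close>, where the boundary clauses apply.\<close>
  have outer: "Fin n = lo \<or> Fin n = hi" if "n \<in> ?I" "n - 1 \<notin> ?I \<or> n + 1 \<notin> ?I" for n
    using index(3,4)[of n] that by blast
  show ?thesis
  proof (intro free_curve_decomposition.intro free_curve_decomposition_axioms.intro)
    show "1 \<in> ?I" "- 1 \<in> ?I" by (fact index)+
    show "r \<in> ?I" if "p \<in> ?I" "q \<in> ?I" "p \<le> r" "r \<le> q" for p q r
      using that by (cases lo; cases hi; auto simp: index_set_def)
    show "preimage (Sg n) \<subseteq> D" for n by (rule preimage_sub)
    show "preimage (Sg 0) = {a..b}" using ab Sg0 by simp
    show "is_interval (preimage (Sg n))" "\<exists>x\<in>preimage (Sg n). \<exists>y\<in>preimage (Sg n). x < y"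
      "embedding_map (top_of_set (preimage (Sg n))) M curve" if "n \<in> ?I" for n
      using pre[OF that] embedding_preimage[OF emb[OF that]] by auto
  next
    fix n assume "n \<in> ?I" "n - 1 \<notin> ?I \<or> n + 1 \<notin> ?I"
    then have "boundary_segment S (topspace S) (Sg n)"
      using outer dec(7) by blast
    then have "connected (preimage (topspace S - Sg n))"
      by (intro connected_preimage) (simp add: boundary_segment_def)
    moreover have "preimage (topspace S - Sg n) = D - preimage (Sg n)"
      using \<upsilon>_image by (auto simp: preimage_def)
    ultimately show "is_interval (D - preimage (Sg n))" by (simp add: is_interval_connected_1)
  next
    fix p q assume pq: "p \<in> ?I" "q \<in> ?I" "\<bar>p - q\<bar> = 1"
    note eq = dec(8)[OF pq]
    then obtain z where z: "Sg p \<inter> Sg q = {z}" by (meson is_singletonE)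
    then have "z \<in> \<upsilon> ` D" using pre(1)[OF pq(1)] \<upsilon>_image by blast
    then obtain x where x: "x \<in> D" "\<upsilon> x = z" by blast
    have "preimage (Sg p) \<inter> preimage (Sg q) = preimage {z}"
      unfolding z[symmetric] by (auto simp: preimage_def)
    also have "\<dots> = {x}" using x inj_\<upsilon> by (auto simp: preimage_def dest: inj_onD)
    finally have "preimage (Sg p) \<inter> preimage (Sg q) = {x}" .
    moreover have "x \<notin> interior (preimage (Sg p))"
      using x z eq by (intro notin_seg_bd) auto
    ultimately show "\<exists>x. preimage (Sg p) \<inter> preimage (Sg q) = {x} \<and> x \<notin> interior (preimage (Sg p))"
      by blast
  next
    fix p q assume pq: "p \<in> ?I" "q \<in> ?I" "\<bar>p - q\<bar> \<ge> 2"
    then have "Sg p \<inter> Sg q = {}" by (rule dec(9))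
    then show "preimage (Sg p) \<inter> preimage (Sg q) = {}" by (auto simp: preimage_def)
  next
    fix n assume n: "n \<in> ?I"
    show "\<exists>g\<in>carrier G. \<exists>Q\<subseteq>{a..b}. c n = g <#\<^bsub>G\<^esub> curve_stabilizer G \<phi> S \<iota> \<and>
      \<phi> g ` curve ` Q = curve ` preimage (Sg n) \<and> (n - 1 \<in> ?I \<and> n + 1 \<in> ?I \<longrightarrow> Q = {a..b})"
    proof (cases "n - 1 \<in> ?I \<and> n + 1 \<in> ?I")
      case True
      then obtain g where g: "g \<in> carrier G" "c n = curve_class G \<phi> S \<iota> g" "\<phi> g ` \<iota> ` Sg 0 = \<iota> ` Sg n"
        using dec(10) index(3)[of n] by blast
      have "0 \<in> ?I" using lo hi index(4)[of 0] by (simp add: zero_extended_def)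
      from curve_preimage[OF pre(1)[OF this]] have "curve ` {a..b} = \<iota> ` Sg 0" using ab Sg0 by simp
      then have "\<phi> g ` curve ` {a..b} = curve ` preimage (Sg n)"
        using g(3) curve_preimage[OF pre(1)[OF n]] by simp
      then show ?thesis
        using g(1) g(2)[unfolded curve_class_def] by (intro bexI[of _ g] exI[of _ "{a..b}"]) simp_all
    next
      case False
      then obtain g B where g: "g \<in> carrier G" "c n = curve_class G \<phi> S \<iota> g"
          "boundary_segment S (Sg 0) B" "\<phi> g ` \<iota> ` B = \<iota> ` Sg n"
        using dec(11) outer[OF n] by blast
      have B: "segment S B" "B \<subseteq> \<Sigma>" using g(3) Sg0 by (auto simp: boundary_segment_def)
      \<comment> \<open>At an extremal index the witness for \<open>Q\<close> is the preimage of the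
        boundary segment \<open>B\<close> of the central piece.\<close>
      then have "preimage B \<subseteq> {a..b}" using ab by (auto simp: preimage_def)
      moreover have "\<phi> g ` curve ` preimage B = curve ` preimage (Sg n)"
        using g(4) curve_preimage[OF segment_preimage(1)[OF B(1)]] curve_preimage[OF pre(1)[OF n]] by simp
      ultimately show ?thesis
        using g(1) g(2)[unfolded curve_class_def] False
        by (intro bexI[of _ g] exI[of _ "preimage B"] conjI impI) (assumption | elim notE)+
    qed
  qed (fact fc)
qed

section \<open>Translates of open segments and uniqueness of the decomposition\<close>

theorem lemma23:
  fixes G :: "('g, 'r) monoid_scheme" and T\<^sub>G :: "'g topology" and \<A>\<^sub>G :: "'g chart set" and k :: nat
    and M :: "'m topology" and \<A>\<^sub>M :: "'m chart set" and d :: nat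
    and \<phi> :: "'g \<Rightarrow> 'm \<Rightarrow> 'm"
    and S :: "'s topology" and \<A>\<^sub>S :: "'s chart set" and \<iota> :: "'s \<Rightarrow> 'm"
    and D :: "real set" and \<upsilon> :: "real \<Rightarrow> 's"
    and \<Sigma> :: "'s set" and lo hi :: "int extended"
    and Sg :: "int \<Rightarrow> 's set" and c :: "int \<Rightarrow> 'g set"
  assumes "lie_group k G T\<^sub>G \<A>\<^sub>G"
    and "analytic_manifold d M \<A>\<^sub>M"
    and "pointwise_continuous_action G T\<^sub>G M \<phi>"
    and "non_contractive G d M \<A>\<^sub>M \<phi>"
    and "analytic_1_submanifold d M \<A>\<^sub>M S \<A>\<^sub>S \<iota>"
    and "free_segments G M \<phi> S \<iota> \<noteq> {}"
    and "interval_parametrization D S \<upsilon>"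
    and "topspace S \<notin> free_segments G M \<phi> S \<iota>"
    and "\<Sigma> \<in> maximal_free_segments G M \<phi> S \<iota>"
    and "compactin S \<Sigma>"
    and "\<Sigma> \<subset> seg_int D \<upsilon> (topspace S)"
    and "segment_decomposition G M \<phi> S \<iota> D \<upsilon> \<Sigma> lo hi Sg c"
  shows "(\<forall>g\<in>carrier G. \<forall>O1 O2.
            open_segment_in S O1 \<and> open_segment_in S O2 \<and>
            embedded_on M S \<iota> O1 \<and> embedded_on M S \<iota> O2 \<and> O1 \<subseteq> Sg 0 \<and>
            \<phi> g ` \<iota> ` O1 = \<iota> ` O2 \<longrightarrow>
            (\<exists>!n. n \<in> index_set lo hi \<and> curve_class G \<phi> S \<iota> g = c n \<and> O2 \<subseteq> Sg n))
       \<and> segment_decomposition G M \<phi> S \<iota> D \<upsilon> \<Sigma> (- hi) (- lo) (\<lambda>n. Sg (- n)) (\<lambda>n. c (- n))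
       \<and> (\<forall>lo' hi' Sg' c'. segment_decomposition G M \<phi> S \<iota> D \<upsilon> \<Sigma> lo' hi' Sg' c' \<longrightarrow>
            (lo' = lo \<and> hi' = hi \<and>
             (\<forall>n\<in>index_set lo hi. Sg' n = Sg n \<and> c' n = c n)) \<or>
            (lo' = - hi \<and> hi' = - lo \<and>
             (\<forall>n\<in>index_set (- hi) (- lo). Sg' n = Sg (- n) \<and> c' n = c (- n))))"
proof -
  have curve: "parametrized_curve M S \<iota> D \<upsilon>"
    using assms(5,7) by unfold_locales (auto simp: analytic_1_submanifold_def analytic_map_def)
  interpret parametrized_curve M S \<iota> D \<upsilon> by (fact curve)
  have free: "\<Sigma> \<in> free_segments G M \<phi> S \<iota>"
    using assms(9) by (simp add: maximal_free_segments_def)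
  have action: "group_action G (topspace M) \<phi>"
    using assms(3) by (simp add: pointwise_continuous_action_def)
  have seg: "segment S \<Sigma>" using free by (simp add: free_segments_def)
  have "connected (preimage \<Sigma>)" "compact (preimage \<Sigma>)"
    using seg connected_preimage compact_preimage assms(10) by (auto simp: segment_def)
  then obtain a b where ab: "preimage \<Sigma> = {a..b}"
    using connected_compact_interval_1 by metis
  note lohi = segment_decompositionD(1,2)[OF assms(12)] and Sg0 = segment_decompositionD(3)[OF assms(12)]
  \<comment> \<open>Embeddedness of the curve on \<open>\<Sigma>\<close> is taken from the
    decomposition, whose piece of index \<open>0\<close> is \<open>\<Sigma>\<close>.\<close>
  from lohi have "0 \<in> index_set lo hi" using index_set_cases(4)[of lo hi 0] by (simp add: zero_extended_def)
  then have emb: "embedded_on M S \<iota> \<Sigma>"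
    using segment_decompositionD(6)[OF assms(12)] Sg0 by blast
  have fc: "free_curve G M \<phi> curve D a b (curve_stabilizer G \<phi> S \<iota>)"
    by (rule free_curve_preimage[OF curve action assms(4) free emb ab])
  note decomposition = free_curve_decomposition_preimage[OF curve fc ab]
  interpret dec: free_curve_decomposition G M \<phi> curve D a b "curve_stabilizer G \<phi> S \<iota>"
    "\<lambda>n. preimage (Sg n)" "index_set lo hi" c
    by (rule decomposition[OF assms(12)])
  have unique_index: "\<exists>!n. n \<in> index_set lo hi \<and> curve_class G \<phi> S \<iota> g = c n \<and> O2 \<subseteq> Sg n"
    if g: "g \<in> carrier G" and O: "open_segment_in S O1" "open_segment_in S O2"
      and embO: "embedded_on M S \<iota> O1" "embedded_on M S \<iota> O2" and sub: "O1 \<subseteq> Sg 0"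
      and eq: "\<phi> g ` \<iota> ` O1 = \<iota> ` O2" for g O1 O2
  proof -
    have seg1: "segment S O1" and seg2: "segment S O2" and "openin S O2"
      using O by (auto simp: open_segment_in_def)
    note pre1 = segment_preimage[OF seg1] and pre2 = segment_preimage[OF seg2]
    have "preimage O1 \<subseteq> {a..b}" using sub ab Sg0 by (auto simp: preimage_def)
    moreover have "openin (top_of_set D) (preimage O2)"
      using openin_iff[OF preimage_sub] image_preimage[OF pre2(1)] \<open>openin S O2\<close> by metis
    moreover have "\<phi> g ` curve ` preimage O1 = curve ` preimage O2"
      using eq curve_preimage[OF pre1(1)] curve_preimage[OF pre2(1)] by simp
    moreover have "connected (preimage O2)" using pre2(2) by (simp add: is_interval_connected_1)
    moreover obtain x y where xy: "x \<in> preimage O2" "y \<in> preimage O2" "x < y" using pre2(3) by blast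
    moreover from xy have "preimage O2 \<noteq> {}" by blast
    ultimately obtain n where n: "n \<in> index_set lo hi"
        "g <#\<^bsub>G\<^esub> curve_stabilizer G \<phi> S \<iota> = c n" "preimage O2 \<subseteq> preimage (Sg n)"
      using dec.translate_in_unique_piece[OF g _ preimage_sub _ embedding_preimage[OF embO(2) pre2(1)]]
      by blast
    have "O2 \<subseteq> Sg n"
      using image_mono[OF n(3), of \<upsilon>] image_preimage[OF pre2(1)] by (auto simp: preimage_def)
    \<comment> \<open>The index is pinned down by two points of \<open>O2\<close> and not by the
      class, which both extremal pieces might carry.\<close>
    moreover have "m = n" if "m \<in> index_set lo hi" "O2 \<subseteq> Sg m" for m
    proof -
      have "preimage O2 \<subseteq> preimage (Sg m)" using that(2) by (auto simp: preimage_def)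
      then show ?thesis using dec.index_unique[OF that(1) n(1), of x y] n(3) xy by auto
    qed
    ultimately show ?thesis
      using n(1,2) unfolding curve_class_def by (intro ex1I[of _ n] conjI) (assumption | elim conjE)+
  qed
  have unique_decomposition: "lo' = lo \<and> hi' = hi \<and> (\<forall>n\<in>index_set lo hi. Sg' n = Sg n \<and> c' n = c n) \<or>
      lo' = - hi \<and> hi' = - lo \<and>
        (\<forall>n\<in>index_set (- hi) (- lo). Sg' n = Sg (- n) \<and> c' n = c (- n))"
    if dec': "segment_decomposition G M \<phi> S \<iota> D \<upsilon> \<Sigma> lo' hi' Sg' c'" for lo' hi' Sg' c'
  proof -
    note lohi' = segment_decompositionD(1,2)[OF dec']
    note sub = segment_preimage(1)[OF segment_decompositionD(5)[OF assms(12)]]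
      and sub' = segment_preimage(1)[OF segment_decompositionD(5)[OF dec']]
    from decomposition_unique[OF decomposition[OF assms(12)] decomposition[OF dec']]
    show ?thesis
    proof (elim disjE conjE)
      assume I: "index_set lo' hi' = index_set lo hi"
        and eq: "\<forall>n\<in>index_set lo hi. preimage (Sg' n) = preimage (Sg n) \<and> c' n = c n"
      have "Sg' n = Sg n" if "n \<in> index_set lo hi" for n
        using eq that sub[OF that] sub'[of n] I by (intro preimage_inject) auto
      then show ?thesis using index_set_inject[OF lohi lohi' I] eq by blast
    next
      assume I: "index_set lo' hi' = uminus ` index_set lo hi"
        and eq: "\<forall>n\<in>uminus ` index_set lo hi. preimage (Sg' n) = preimage (Sg (- n)) \<and> c' n = c (- n)"
      have "Sg' n = Sg (- n)" if "n \<in> uminus ` index_set lo hi" for n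
        using eq that sub[of "- n"] sub'[of n] I by (intro preimage_inject) auto
      \<comment> \<open>With these signs the bounds can be recovered from the reversed index
        set.\<close>
      moreover have "- hi < 0" "0 < - lo"
        using lohi by (cases hi; cases lo; auto simp: zero_extended_def)+
      then have "lo' = - hi" "hi' = - lo"
        using index_set_inject[of "- hi" "- lo" lo' hi'] lohi' I index_set_uminus by metis+
      ultimately show ?thesis using eq by (simp add: index_set_uminus)
    qed
  qed
  show ?thesis
  proof (intro conjI ballI allI impI)
    fix g O1 O2
    assume "g \<in> carrier G" and "open_segment_in S O1 \<and> open_segment_in S O2 \<and>
      embedded_on M S \<iota> O1 \<and> embedded_on M S \<iota> O2 \<and> O1 \<subseteq> Sg 0 \<and> \<phi> g ` \<iota> ` O1 = \<iota> ` O2"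
    then show "\<exists>!n. n \<in> index_set lo hi \<and> curve_class G \<phi> S \<iota> g = c n \<and> O2 \<subseteq> Sg n"
      by (elim conjE) (rule unique_index)
  qed (fact segment_decomposition_reverse[OF assms(12)] unique_decomposition)+
qed

end
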